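(* Let $x,y,c\in\mathbb{C}\setminus\{0\}$ with $x,\,y,\,x/c,\,yc\notin q^{\mathbb{Z}}$. For all $m,n\in\mathbb{Z}$, (1) $$l\widehat{\mu}\Bigl(\frac xcq^{n-1},yc\Bigr)l\widehat{\mu}(xq^{m-1},y)-l\widehat{\mu}\Bigl(\frac xcq^{m-1},yc\Bigr)l\widehat{\mu}(xq^{n-1},y)=\frac{q^{-1/4}\theta(c)\theta(yc/x)}{\theta(c/x)\theta(yc)\theta(x)\theta(y)}\bigl(S_m(xy,q)T_{n-1}(xy,q)-S_n(xy,q)T_{m-1}(xy,q)\bigr),$$ (2) $$(-xy)^nq^{\frac{n(n-1)}{2}}{}_0\phi_1\left(\begin{matrix}-\\0\end{matrix};q;xyq^{n+1}\right)l\widehat{\mu}(xq^{m-1},y)-(-xy)^mq^{\frac{m(m-1)}{2}}{}_0\phi_1\left(\begin{matrix}-\\0\end{matrix};q;xyq^{m+1}\right)l\widehat{\mu}(xq^{n-1},y)$$ $$=iq^{-1/8}\bigl(S_m(xy,q)T_{n-1}(xy,q)-S_n(xy,q)T_{m-1}(xy,q)\bigr).$$ In particular, for $m=n+1$, (3) $$l\widehat{\mu}\Bigl(\frac xcq^{n-1},yc\Bigr)l\widehat{\mu}(xq^{n},y)-l\widehat{\mu}\Bigl(\frac xcq^{n},yc\Bigr)l\widehat{\mu}(xq^{n-1},y)=\frac{(-xy)^nq^{\frac{n(n-1)}{2}-\frac14}\theta(c)\theta(yc/x)}{\theta(c/x)\theta(yc)\theta(x)\theta(y)},$$ (4) $${}_0\phi_1\left(\begin{matrix}-\\0\end{matrix};q;xyq^{n+1}\right)l\widehat{\mu}(xq^n,y)+xyq^n\,{}_0\phi_1\left(\begin{matrix}-\\0\end{matrix};q;xyq^{n+2}\right)l\widehat{\mu}(xq^{n-1},y)=iq^{-1/8}.$$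 Furthermore, for $n=0$, (5) $$l\widehat{\mu}\Bigl(\frac{x}{cq},yc\Bigr)l\widehat{\mu}(x,y)-l\widehat{\mu}\Bigl(\frac xc,yc\Bigr)l\widehat{\mu}\Bigl(\frac xq,y\Bigr)=\frac{q^{-1/4}\theta(c)\theta(yc/x)}{\theta(c/x)\theta(yc)\theta(x)\theta(y)},$$ (6) $${}_0\phi_1\left(\begin{matrix}-\\0\end{matrix};q;xyq\right)l\widehat{\mu}(x,y)+xy\,{}_0\phi_1\left(\begin{matrix}-\\0\end{matrix};q;xyq^2\right)l\widehat{\mu}(x/q,y)=iq^{-1/8}.$$
   Context: Let $i=\sqrt{-1}$, $\tau\in\mathbb{C}$ with $\mathrm{Im}(\tau)>0$, $q=e^{2\pi i\tau}$, $q^s=e^{2\pi i\tau s}$, $q^{\mathbb{Z}}=\{q^n:n\in\mathbb{Z}\}$. Set $(x)_\infty=\prod_{n\ge0}(1-xq^n)$, $(x)_n=(x)_\infty/(xq^n)_\infty$ for $n\in\mathbb{Z}$ (so $(0)_n=1$), $(a_1,\dots,a_r)_\beta=\prod_j(a_j)_\beta$ for $\beta\in\mathbb{Z}\cup\{\infty\}$, and $\theta(x)=(x,q/x)_\infty$. Series: ${}_0\phi_1\left(\begin{matrix}-\\0\end{matrix};q;x\right)=\sum_{n\ge0}\frac{q^{n(n-1)}}{(q)_n}x^n$ and ${}_1\psi_2\left(\begin{matrix}x\\0,0\end{matrix};q;z\right)=\sum_{n\in\mathbb{Z}}(x)_n(-1)^nq^{n(n-1)/2}z^n$. The little $\mu$-function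 is, for nonzero $x,y\notin q^{\mathbb{Z}}$, $$l\widehat{\mu}(x,y)=\frac{iq^{-1/8}}{(x,q)_\infty\theta(qy)}\,{}_1\psi_2\left(\begin{matrix}x\\0,0\end{matrix};q;\frac1y\right).$$ The $q,t$-Fibonacci sequences $(S_n(t,q))_{n\in\mathbb{Z}}$ and $(T_{n-1}(t,q))_{n\in\mathbb{Z}}$ (for $t\ne0$) are the unique solutions $F_n=S_n$ and $F_n=T_{n-1}$ of $F_n(t,q)=F_{n-1}(t,q)+tq^{n-2}F_{n-2}(t,q)$ $(n\in\mathbb{Z})$ with initial values $F_0=S_0=0$, $F_1=S_1=1$ and $F_0=T_{-1}=1$, $F_1=T_0=0$ respectively. *)

theory Defs
  imports "HOL-Analysis.Analysis"
begin

definition qpow :: "complex \<Rightarrow> real \<Rightarrow> complex" where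
  "qpow \<tau> s = exp (2 * of_real pi * \<i> * \<tau> * of_real s)"

abbreviation nome :: "complex \<Rightarrow> complex" where
  "nome \<tau> \<equiv> qpow \<tau> 1"

definition qint_powers :: "complex \<Rightarrow> complex set" where
  "qint_powers q = range (\<lambda>n::int. q powi n)"

definition qpoch_inf :: "complex \<Rightarrow> complex \<Rightarrow> complex" where
  "qpoch_inf q x = (\<Prod>n. 1 - x * q ^ n)"

text \<open>When the denominator vanishes, i.e. when x is an integer power of q with
  \<open>x * q powi n\<close> a nonpositive power, the value is the conventional 0 of HOL division.
  This does not occur below: x is not an integer power of q, or x = q and \<open>n \<ge> 0\<close>.\<close>

definition qpoch :: "complex \<Rightarrow> complex \<Rightarrow> int \<Rightarrow> complex" where
  "qpoch q x n = qpoch_inf q x / qpoch_inf q (x * q powi n)"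

definition theta :: "complex \<Rightarrow> complex \<Rightarrow> complex" where
  "theta q x = qpoch_inf q x * qpoch_inf q (q / x)"

text \<open>The series \<open>\<^sub>0\<phi>\<^sub>1(-; 0; q; x)\<close>; on naturals \<open>n * (n - 1)\<close> is also right at \<open>n = 0\<close>.\<close>

definition phi01 :: "complex \<Rightarrow> complex \<Rightarrow> complex" where
  "phi01 q x = (\<Sum>n. q ^ (n * (n - 1)) / qpoch q q (int n) * x ^ n)"

text \<open>The bilateral series \<open>\<^sub>1\<psi>\<^sub>2(x; 0, 0; q; z)\<close>, which converges absolutely for
  \<open>0 < norm q < 1\<close>, \<open>z \<noteq> 0\<close> and x neither 0 nor an integer power of q; \<open>n * (n - 1)\<close> is
  even, so \<open>div\<close> is exact.\<close>

definition psi12 :: "complex \<Rightarrow> complex \<Rightarrow> complex \<Rightarrow> complex" where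
  "psi12 q x z =
     (\<Sum>\<^sub>\<infinity>n::int. qpoch q x n * (-1) powi n * q powi (n * (n - 1) div 2) * z powi n)"

definition little_mu :: "complex \<Rightarrow> complex \<Rightarrow> complex \<Rightarrow> complex" where
  "little_mu \<tau> x y =
     (let q = nome \<tau> in
        \<i> * qpow \<tau> (- 1 / 8) / (qpoch_inf q x * qpoch_inf q q * theta q (q * y))
          * psi12 q x (1 / y))"

definition qt_fib_rec :: "complex \<Rightarrow> complex \<Rightarrow> (int \<Rightarrow> complex) \<Rightarrow> bool" where
  "qt_fib_rec t q F \<longleftrightarrow> (\<forall>n. F n = F (n - 1) + t * q powi (n - 2) * F (n - 2))"

definition fibS :: "int \<Rightarrow> complex \<Rightarrow> complex \<Rightarrow> complex" where
  "fibS n t q = (THE F. qt_fib_rec t q F \<and> F 0 = 0 \<and> F 1 = 1) n"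

text \<open>The solution F of the recurrence is \<open>F n = T (n - 1)\<close>, hence the shift of the index.\<close>

definition fibT :: "int \<Rightarrow> complex \<Rightarrow> complex \<Rightarrow> complex" where
  "fibT n t q = (THE F. qt_fib_rec t q F \<and> F 0 = 1 \<and> F 1 = 0) (n + 1)"

text \<open>The definite descriptions above are well defined for nonzero t and q.\<close>

lemma qt_fib_unique_solution:
  assumes "t \<noteq> 0" "q \<noteq> 0"
  shows "\<exists>!F. qt_fib_rec t q F \<and> F 0 = a \<and> F 1 = b"
proof -
  define c where "c n = t * q powi (n - 2)" for n :: int
  have c: "c n \<noteq> 0" for n using assms by (simp add: c_def)
  define up where "up = rec_nat (a, b) (\<lambda>k p. (snd p, snd p + c (int k + 2) * fst p))"
  define dn where "dn = rec_nat (a, b) (\<lambda>k p. ((snd p - fst p) / c (1 - int k), fst p))"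
  have up: "up 0 = (a, b)"
    "up (Suc k) = (snd (up k), snd (up k) + c (int k + 2) * fst (up k))" for k
    by (simp_all add: up_def)
  have dn: "dn 0 = (a, b)"
    "dn (Suc k) = ((snd (dn k) - fst (dn k)) / c (1 - int k), fst (dn k))" for k
    by (simp_all add: dn_def)
  define F where "F n = (if n \<ge> 0 then fst (up (nat n)) else fst (dn (nat (- n))))" for n
  have Fup: "F (int k) = fst (up k)" for k by (simp add: F_def)
  have Fdn: "F (- int k) = fst (dn k)" for k
    by (cases "k = 0") (simp_all add: F_def up dn)
  have F1: "F 1 = b" using Fup[of 1] by (simp add: up)
  have sdn: "snd (dn k) = F (1 - int k)" for k
    by (cases k) (use F1 Fdn in \<open>simp_all add: dn\<close>)
  have rec: "F n = F (n - 1) + c n * F (n - 2)" for n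
  proof (cases "n \<ge> 2")
    case True
    define k where "k = nat (n - 2)"
    have n: "n = int (Suc (Suc k))" "n - 1 = int (Suc k)" "n - 2 = int k" "int k + 2 = n"
      using True by (simp_all add: k_def)
    have "F n = fst (up (Suc (Suc k)))"
      unfolding Fup[symmetric] using n(1) by simp
    then have "F n = snd (up k) + c n * fst (up k)"
      by (simp only: up n(4) fst_conv snd_conv)
    moreover have "F (n - 1) = snd (up k)"
      unfolding n(2) Fup by (simp add: up)
    moreover have "F (n - 2) = fst (up k)"
      unfolding n(3) Fup ..
    ultimately show ?thesis by simp
  next
    case False
    define k where "k = nat (1 - n)"
    have n: "n = 1 - int k" "n - 1 = - int k" "n - 2 = - int (Suc k)"
      using False by (simp_all add: k_def)
    have "F (n - 2) = (snd (dn k) - fst (dn k)) / c n"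
      unfolding n(3) Fdn using n(1) by (simp add: dn)
    moreover have "F (n - 1) = fst (dn k)"
      unfolding n(2) Fdn ..
    moreover have "F n = snd (dn k)" using sdn n(1) by simp
    ultimately show ?thesis using c[of n] by simp
  qed
  show ?thesis
  proof (rule ex1I[of _ F])
    have "qt_fib_rec t q F"
      unfolding qt_fib_rec_def using rec unfolding c_def by blast
    moreover have "F 0 = a" using Fup[of 0] by (simp add: up)
    ultimately show "qt_fib_rec t q F \<and> F 0 = a \<and> F 1 = b" using F1 by blast
  next
    fix G assume G: "qt_fib_rec t q G \<and> G 0 = a \<and> G 1 = b"
    then have Grec: "G n = G (n - 1) + c n * G (n - 2)" for n
      unfolding qt_fib_rec_def c_def by blast
    have u: "G (int k) = fst (up k) \<and> G (int k + 1) = snd (up k)" for k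
    proof (induction k)
      case 0 then show ?case using G by (simp add: up)
    next
      case (Suc k)
      have "int k + 2 - 1 = int k + 1" "int k + 2 - 2 = int k" by simp_all
      then have "G (int k + 2) = G (int k + 1) + c (int k + 2) * G (int k)"
        using Grec[of "int k + 2"] by metis
      moreover have "int (Suc k) = int k + 1" "int (Suc k) + 1 = int k + 2" by simp_all
      ultimately show ?case using Suc by (simp only: up fst_conv snd_conv)
    qed
    have d: "G (- int k) = fst (dn k) \<and> G (1 - int k) = snd (dn k)" for k
    proof (induction k)
      case 0 then show ?case using G by (simp add: dn)
    next
      case (Suc k)
      have "1 - int k - 2 = - int (Suc k)" "1 - int k - 1 = - int k" by simp_all
      then have "G (1 - int k) = G (- int k) + c (1 - int k) * G (- int (Suc k))"
        using Grec[of "1 - int k"] by metis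
      then have "G (- int (Suc k)) = (snd (dn k) - fst (dn k)) / c (1 - int k)"
        using Suc c[of "1 - int k"] by (simp add: field_simps)
      then show ?case using Suc by (simp add: dn)
    qed
    show "G = F"
    proof
      fix n :: int
      show "G n = F n" using u[of "nat n"] d[of "nat (- n)"]
        by (cases "n \<ge> 0") (simp_all add: F_def)
    qed
  qed
qed

end

theory Submission
  imports Defs
begin

text \<open>
Fix \<open>t = x y\<close>. Everything rests on the observation that
\<open>A n = little_mu \<tau> (x / c * q powi (n - 1)) (y * c)\<close>, \<open>B n = little_mu \<tau> (x * q powi (n - 1)) y\<close> and
\<open>H n = (- t) powi n * q powi (n * (n - 1) div 2) * phi01 q (t * q powi (n + 1))\<close> are three solutions
of one and the same recurrence, that of the \<open>q,t\<close>-Fibonacci sequences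
(\<open>qt_fib_rec_little_mu\<close>, \<open>qt_fib_rec_phi01\<close>). Its solution space has dimension two, so the
antisymmetric expression \<open>F n * G m - F m * G n\<close> of two solutions is its value for \<open>n = 0\<close>, \<open>m = 1\<close>
times the expression in S and T (\<open>casorati_eq\<close>), and for \<open>m = n + 1\<close> it has a closed form
(\<open>casorati_closed_form\<close>). All six identities follow once the two Casoratians at 0, of H with B and of
A with B, are known.

For H with B, divide by the closed form and let n tend to infinity: \<open>\<^sub>0\<phi>\<^sub>1\<close> tends to 1, and the
bilateral series in the little \<open>\<mu>\<close>-function tends termwise to Jacobi's theta series, which the
Jacobi triple product evaluates (\<open>phi01_mu_sum_casorati\<close>). The triple product itself is derived from
Euler's two expansions.

For A with B this limit gives no information. Instead, \<open>A - B\<close> turns out to be a constant multiple of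
H (\<open>little_mu_diff\<close>), which reduces the second Casoratian to the first. The reason is that, for fixed
t, the little \<open>\<mu>\<close>-function times \<open>theta q x * theta q y\<close> is a theta function of degree 2 in x up to an
elementary factor. Such functions form a space of dimension two, whose antisymmetric form is a product
of theta functions (\<open>theta_series_product\<close>); this yields a three-term relation
(\<open>cleared_mu_series_three_term\<close>) in which the only unknown constant is the value at x = 1, and that value is a \<open>\<^sub>0\<phi>\<^sub>1\<close>.
\<close>

section \<open>q-shifted factorials\<close>

lemma convergent_prod_qpoch:
  fixes q z :: complex assumes "norm q < 1"
  shows "convergent_prod (\<lambda>n. 1 - z * q ^ n)"
proof -
  have "summable (\<lambda>n. norm (z * q ^ n))"
    using assms by (simp add: norm_mult norm_power summable_geometric summable_mult)
  then have "summable (\<lambda>n. norm ((1 - z * q ^ n) - 1))" by simp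
  then show ?thesis
    by (intro abs_convergent_prod_imp_convergent_prod summable_imp_abs_convergent_prod)
qed

lemma qpoch_inf_LIMSEQ:
  fixes q z :: complex assumes "norm q < 1"
  shows "(\<lambda>N. \<Prod>i<N. 1 - z * q ^ i) \<longlonglongrightarrow> qpoch_inf q z"
proof -
  have "(\<lambda>n. \<Prod>i\<le>n. 1 - z * q ^ i) \<longlonglongrightarrow> qpoch_inf q z"
    unfolding qpoch_inf_def by (rule convergent_prod_LIMSEQ[OF convergent_prod_qpoch[OF assms]])
  then have "(\<lambda>n. \<Prod>i<Suc n. 1 - z * q ^ i) \<longlonglongrightarrow> qpoch_inf q z"
    by (simp add: lessThan_Suc_atMost)
  then show ?thesis by (rule LIMSEQ_imp_Suc)
qed

lemma qpoch_inf_head: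
  fixes q z :: complex assumes "norm q < 1"
  shows "qpoch_inf q z = (1 - z) * qpoch_inf q (q * z)"
proof -
  have "(\<lambda>N. (1 - z) * (\<Prod>i<N. 1 - (q * z) * q ^ i)) \<longlonglongrightarrow> (1 - z) * qpoch_inf q (q * z)"
    by (intro tendsto_intros qpoch_inf_LIMSEQ assms)
  moreover have "(1 - z) * (\<Prod>i<N. 1 - (q * z) * q ^ i) = (\<Prod>i<Suc N. 1 - z * q ^ i)" for N
    by (subst prod.lessThan_Suc_shift) (simp add: mult_ac)
  ultimately have "(\<lambda>N. \<Prod>i<Suc N. 1 - z * q ^ i) \<longlonglongrightarrow> (1 - z) * qpoch_inf q (q * z)"
    by simp
  moreover have "(\<lambda>N. \<Prod>i<Suc N. 1 - z * q ^ i) \<longlonglongrightarrow> qpoch_inf q z"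
    using qpoch_inf_LIMSEQ[OF assms] by (rule LIMSEQ_Suc)
  ultimately show ?thesis using LIMSEQ_unique by blast
qed

lemma qpoch_inf_split:
  fixes q z :: complex assumes "norm q < 1"
  shows "qpoch_inf q z = (\<Prod>i<n. 1 - z * q ^ i) * qpoch_inf q (q ^ n * z)"
proof (induction n)
  case (Suc n)
  then show ?case
    using qpoch_inf_head[OF assms, of "q ^ n * z"] by (simp add: mult_ac)
qed simp

lemma qpoch_inf_nonzero:
  fixes q z :: complex assumes "norm q < 1" "\<And>n. 1 \<noteq> z * q ^ n"
  shows "qpoch_inf q z \<noteq> 0"
  unfolding qpoch_inf_def
  by (rule prodinf_nonzero[OF convergent_prod_qpoch[OF assms(1)]]) (use assms(2) in simp)

lemma qpoch_inf_eq_0: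
  fixes q z :: complex assumes "norm q < 1" "z * q ^ n = 1"
  shows "qpoch_inf q z = 0"
proof -
  have "(\<Prod>i<Suc n. 1 - z * q ^ i) = 0" using assms(2) by simp
  then show ?thesis using qpoch_inf_split[OF assms(1), of z "Suc n"] by simp
qed

text \<open>The values \<open>qpoch q q (int n)\<close> as finite products, which are easier
  to bound and to step than quotients of infinite products (see
  \<open>qpoch_eq_qfac\<close>).\<close>

definition qfac :: "complex \<Rightarrow> nat \<Rightarrow> complex" where
  "qfac q n = (\<Prod>i<n. 1 - q * q ^ i)"

lemma q_power_Suc_neq_1:
  fixes q :: complex assumes "norm q < 1" shows "q * q ^ n \<noteq> 1"
proof
  assume "q * q ^ n = 1"
  then have "norm q ^ Suc n = 1" by (metis norm_one norm_power power_Suc)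
  moreover have "norm q ^ Suc n < 1" using assms by (subst power_less_one_iff) auto
  ultimately show False by simp
qed

lemma qpoch_qq_nonzero:
  fixes q :: complex assumes "norm q < 1" shows "qpoch_inf q q \<noteq> 0"
  by (rule qpoch_inf_nonzero[OF assms q_power_Suc_neq_1[OF assms, THEN not_sym]])

lemma qfac_Suc: "qfac q (Suc n) = qfac q n * (1 - q ^ Suc n)"
  by (simp add: qfac_def)

lemma qfac_0 [simp]: "qfac q 0 = 1" by (simp add: qfac_def)

lemma qfac_nonzero:
  fixes q :: complex assumes "norm q < 1" shows "qfac q n \<noteq> 0"
  using q_power_Suc_neq_1[OF assms, THEN not_sym] by (simp add: qfac_def)

lemma qpoch_inf_qfac:
  fixes q :: complex assumes "norm q < 1"
  shows "qpoch_inf q q = qfac q n * qpoch_inf q (q ^ Suc n)"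
  using qpoch_inf_split[OF assms, of q n] by (simp add: qfac_def mult_ac)

lemma qpoch_eq_qfac:
  fixes q :: complex assumes "norm q < 1"
  shows "qpoch q q (int n) = qfac q n"
  using qpoch_inf_qfac[OF assms, of n] qpoch_qq_nonzero[OF assms]
  by (simp add: qpoch_def)

lemma inverse_qfac_bounded:
  fixes q :: complex assumes "norm q < 1"
  obtains C where "\<And>n. norm (1 / qfac q n) \<le> C"
proof -
  have "(\<lambda>n. 1 / qfac q n) \<longlonglongrightarrow> 1 / qpoch_inf q q"
    unfolding qfac_def
    by (intro tendsto_intros qpoch_inf_LIMSEQ assms qpoch_qq_nonzero)
  then have "Bseq (\<lambda>n. 1 / qfac q n)"
    by (intro convergent_imp_Bseq convergentI)
  then show ?thesis using that unfolding Bseq_def by blast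
qed

lemma summable_div_qfac:
  fixes q :: complex and f :: "nat \<Rightarrow> complex"
  assumes "norm q < 1" "summable (\<lambda>n. norm (f n))"
  shows "summable (\<lambda>n. norm (f n / qfac q (h n)))"
proof -
  obtain C where C: "\<And>n. norm (1 / qfac q n) \<le> C" using inverse_qfac_bounded[OF assms(1)] by blast
  show ?thesis
  proof (rule summable_comparison_test')
    show "summable (\<lambda>n. norm (f n) * C)" by (rule summable_mult2[OF assms(2)])
    fix n
    show "norm (norm (f n / qfac q (h n))) \<le> norm (f n) * C"
      using mult_left_mono[OF C[of "h n"] norm_ge_zero, of "f n"] by (simp add: norm_divide)
  qed
qed

lemma qpoch_inf_nonzero_generic:
  fixes q z :: complex assumes "q \<noteq> 0" "norm q < 1" "z \<notin> qint_powers q"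
  shows "qpoch_inf q z \<noteq> 0"
proof (rule qpoch_inf_nonzero[OF assms(2)])
  fix n
  show "1 \<noteq> z * q ^ n"
  proof
    assume "1 = z * q ^ n"
    then have "z = q powi (- int n)" using assms(1) by (simp add: power_int_minus field_simps)
    then show False using assms(3) by (auto simp: qint_powers_def)
  qed
qed

lemma qint_powers_mult_iff:
  fixes q z :: complex assumes "q \<noteq> 0"
  shows "z * q powi k \<in> qint_powers q \<longleftrightarrow> z \<in> qint_powers q"
proof
  assume "z * q powi k \<in> qint_powers q"
  then obtain n where "z * q powi k = q powi n" by (auto simp: qint_powers_def)
  then have "z = q powi (n - k)" using assms by (simp add: power_int_diff field_simps)
  then show "z \<in> qint_powers q" by (simp add: qint_powers_def)
next
  assume "z \<in> qint_powers q"
  then obtain n where "z = q powi n" by (auto simp: qint_powers_def)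
  then have "z * q powi k = q powi (n + k)" using assms by (simp add: power_int_add)
  then show "z * q powi k \<in> qint_powers q" by (simp add: qint_powers_def)
qed

lemma qint_powers_inverse_iff:
  fixes q z :: complex assumes "q \<noteq> 0"
  shows "1 / z \<in> qint_powers q \<longleftrightarrow> z \<in> qint_powers q"
proof -
  have *: "1 / w \<in> qint_powers q" if w: "w \<in> qint_powers q" for w
  proof -
    obtain n where "w = q powi n" using w by (auto simp: qint_powers_def)
    then have "1 / w = q powi (- n)" by (simp add: power_int_minus divide_inverse)
    then show ?thesis by (simp add: qint_powers_def)
  qed
  show ?thesis using *[of z] *[of "1 / z"] by auto
qed

section \<open>Convergence of theta series\<close>

definition tri :: "int \<Rightarrow> int" where "tri n = n * (n - 1) div 2"

lemma two_tri: "2 * tri n = n * (n - 1)"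
proof -
  have "2 dvd n * (n - 1)" by (cases "even n") auto
  then show ?thesis by (simp add: tri_def)
qed

lemma tri_eqI: "2 * k = n * (n - 1) \<Longrightarrow> tri n = k"
  using two_tri[of n] by linarith

lemma tri_add: "tri (m + n) = tri m + tri n + m * n"
  by (rule tri_eqI) (simp only: distrib_left two_tri, simp add: algebra_simps)

lemma tri_Suc: "tri (n + 1) = tri n + n"
  by (rule tri_eqI) (simp only: distrib_left two_tri, simp add: algebra_simps)

lemma tri_0 [simp]: "tri 0 = 0" and tri_1 [simp]: "tri 1 = 0" by (simp_all add: tri_def)

lemma tri_minus: "tri (- n) = tri n + n"
  by (rule tri_eqI) (simp only: distrib_left two_tri, simp add: algebra_simps)

lemma tri_reflect: "tri (1 - n) = tri n"
  by (rule tri_eqI) (simp only: two_tri, simp add: algebra_simps)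

lemma theta_series_norm_summable_nat:
  fixes q z :: complex assumes "q \<noteq> 0" "norm q < 1"
  shows "summable (\<lambda>n::nat. norm (q powi tri (int n) * z ^ n))"
proof -
  have "(\<lambda>n. norm (q ^ n * z)) \<longlonglongrightarrow> 0"
    using assms(2) by (auto intro!: tendsto_eq_intros LIMSEQ_power_zero)
  then have "eventually (\<lambda>n. norm (q ^ n * z) < 1 / 2) sequentially"
    by (rule order_tendstoD) simp
  then obtain N where N: "\<And>n. n \<ge> N \<Longrightarrow> norm (q ^ n * z) < 1 / 2"
    by (auto simp: eventually_sequentially)
  show ?thesis
  proof (rule summable_ratio_test[of "1 / 2" N])
    fix n assume "n \<ge> N"
    have "tri (int (Suc n)) = tri (int n) + int n"
      using tri_Suc[of "int n"] by (simp add: add.commute)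
    then have "q powi tri (int (Suc n)) * z ^ Suc n = (q ^ n * z) * (q powi tri (int n) * z ^ n)"
      using assms(1) by (simp add: power_int_add)
    then have "norm (q powi tri (int (Suc n)) * z ^ Suc n) = norm (q ^ n * z) * norm (q powi tri (int n) * z ^ n)"
      by (simp only: norm_mult)
    also have "\<dots> \<le> 1 / 2 * norm (q powi tri (int n) * z ^ n)"
      using N[OF \<open>n \<ge> N\<close>] by (intro mult_right_mono) auto
    finally show "norm (norm (q powi tri (int (Suc n)) * z ^ Suc n)) \<le> 1 / 2 * norm (norm (q powi tri (int n) * z ^ n))"
      by simp
  qed simp
qed

text \<open>Both halves are dominated by Gaussian decay; reflecting \<open>n\<close> turns the
  negative half into the positive one with \<open>z\<close> replaced by
  \<open>q / z\<close>.\<close>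

lemma theta_series_summable:
  fixes q z :: complex assumes "q \<noteq> 0" "norm q < 1" "z \<noteq> 0"
  shows "(\<lambda>n::int. norm (q powi tri n * z powi n)) summable_on UNIV"
proof -
  let ?f = "\<lambda>n::int. norm (q powi tri n * z powi n)"
  have nat: "(\<lambda>n::nat. norm (q powi tri (int n) * w ^ n)) summable_on UNIV" for w
    using theta_series_norm_summable_nat[OF assms(1,2)]
    by (intro norm_summable_imp_summable_on) simp
  have "?f summable_on range int"
    using nat[of z] by (subst summable_on_reindex) (auto simp: o_def)
  moreover have "?f summable_on range (\<lambda>n. - int n)"
  proof (subst summable_on_reindex)
    have "q powi tri (- int n) * z powi (- int n) = q powi tri (int n) * (q / z) ^ n" for n
      using assms by (simp add: tri_minus power_int_add power_int_minus field_simps)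
    then show "(?f \<circ> (\<lambda>n. - int n)) summable_on UNIV"
      using nat[of "q / z"] by (simp add: o_def)
  qed (auto simp: inj_on_def)
  then have "?f summable_on (range (\<lambda>n. - int n) - range int)"
    by (rule summable_on_subset_banach) auto
  ultimately have "?f summable_on (range int \<union> (range (\<lambda>n. - int n) - range int))"
    by (intro summable_on_Un_disjoint) auto
  moreover have "range int \<union> (range (\<lambda>n. - int n) - range int) = UNIV"
  proof -
    have "n \<in> range int \<union> range (\<lambda>n. - int n)" for n :: int
      by (cases n rule: int_cases4) auto
    then show ?thesis by auto
  qed
  ultimately show ?thesis by simp
qed

text \<open>Jacobi's bilateral series with all signs moved into the argument; in these terms the
  Jacobi triple product is the evaluation at \<open>- z\<close>.\<close>

definition theta_series :: "complex \<Rightarrow> complex \<Rightarrow> complex" where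
  "theta_series q z = (\<Sum>\<^sub>\<infinity>n::int. q powi tri n * z powi n)"

lemma theta_series_has_sum:
  fixes q z :: complex assumes "q \<noteq> 0" "norm q < 1" "z \<noteq> 0"
  shows "((\<lambda>n::int. q powi tri n * z powi n) has_sum theta_series q z) UNIV"
  unfolding theta_series_def
  by (rule has_sum_infsum, rule abs_summable_summable, rule theta_series_summable[OF assms])

lemma theta_series_mult_q:
  fixes q z :: complex assumes "q \<noteq> 0" "norm q < 1" "z \<noteq> 0"
  shows "theta_series q (q * z) = theta_series q z / z"
proof -
  have "((\<lambda>n::int. (q powi tri n * z powi n) / z) has_sum (theta_series q z / z)) UNIV"
    using has_sum_cmult_left[OF theta_series_has_sum[OF assms], of "1 / z"] by simp
  moreover have "((\<lambda>n::int. q powi tri n * (q * z) powi n) has_sum (theta_series q z / z)) UNIV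
     \<longleftrightarrow> ((\<lambda>n::int. (q powi tri n * z powi n) / z) has_sum (theta_series q z / z)) UNIV"
    by (rule has_sum_reindex_bij_witness[where i = "\<lambda>n. n - 1" and j = "\<lambda>n. n + 1"])
       (use assms in \<open>auto simp: tri_Suc power_int_add power_int_mult_distrib field_simps\<close>)
  ultimately have "((\<lambda>n::int. q powi tri n * (q * z) powi n) has_sum (theta_series q z / z)) UNIV" by blast
  then show ?thesis using theta_series_has_sum[of q "q * z"] assms has_sum_unique by fastforce
qed

section \<open>Euler's expansions\<close>

text \<open>Iterating a q-difference equation drives the argument to 0, where a power series tends
  to its constant term.\<close>

lemma powser_limit_scaled:
  fixes a :: "nat \<Rightarrow> complex" and q z :: complex
  assumes "\<And>w. norm w < r \<Longrightarrow> (\<lambda>n. a n * w ^ n) sums f w" "norm q < 1" "r > 0"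
  shows "(\<lambda>N. f (q ^ N * z)) \<longlonglongrightarrow> a 0"
proof -
  have "(f \<longlongrightarrow> a 0) (at 0)"
    by (rule powser_limit_0[OF assms(3)]) (use assms(1) in auto)
  moreover have "f 0 = a 0" using assms(1)[of 0] assms(3) by (auto simp: powser_sums_zero_iff)
  ultimately have "isCont f 0" by (simp add: isCont_def)
  moreover have "(\<lambda>N. q ^ N * z) \<longlonglongrightarrow> 0"
    using assms(2) by (auto intro!: tendsto_eq_intros LIMSEQ_power_zero)
  ultimately have "(\<lambda>N. f (q ^ N * z)) \<longlonglongrightarrow> f 0" by (rule isCont_tendsto_compose)
  then show ?thesis using \<open>f 0 = a 0\<close> by simp
qed

text \<open>For checking q-difference equations of power series coefficientwise: multiplication by
  z moves the coefficient of degree n to degree n + 1.\<close>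

lemma powser_q_difference:
  fixes a :: "nat \<Rightarrow> complex"
  assumes "f1 sums s1" "f2 sums s2" "f1 0 = f2 0" "\<And>n. f1 (Suc n) - f2 (Suc n) = z * f3 n" "f3 sums s3"
  shows "s1 - s2 = z * (s3::complex)"
proof -
  have "(\<lambda>n. f1 n - f2 n) sums (s1 - s2)" by (intro sums_diff assms)
  then have "(\<lambda>n. f1 (Suc n) - f2 (Suc n)) sums (s1 - s2)"
    using assms(3) by (subst sums_Suc_iff) simp
  then have "(\<lambda>n. z * f3 n) sums (s1 - s2)" using assms(4) by simp
  moreover have "(\<lambda>n. z * f3 n) sums (z * s3)" by (intro sums_mult assms)
  ultimately show ?thesis by (rule sums_unique2)
qed

lemma euler_term_summable:
  fixes q z :: complex assumes "q \<noteq> 0" "norm q < 1"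
  shows "summable (\<lambda>j::nat. norm (q powi tri (int j) / qfac q j * z ^ j))"
  using summable_div_qfac[OF assms(2) theta_series_norm_summable_nat[OF assms], of z "\<lambda>j. j"]
  by simp

text \<open>Both sides solve \<open>E(z) = (1 - z) E(q z)\<close>; iterating it N times
  writes the series as the partial product times \<open>E(q\<^sup>N z)\<close>, which tends to
  \<open>E(0) = 1\<close>.\<close>

theorem euler_expansion:
  fixes q z :: complex assumes "q \<noteq> 0" "norm q < 1"
  shows "(\<lambda>j::nat. q powi tri (int j) / qfac q j * (- z) ^ j) sums qpoch_inf q z"
proof -
  define a where "a j = q powi tri (int j) / qfac q j * (- 1) ^ j" for j :: nat
  define E where "E w = (\<Sum>j. a j * w ^ j)" for w
  have a: "a j * w ^ j = q powi tri (int j) / qfac q j * (- w) ^ j" for j w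
    using power_minus[of w j] by (simp add: a_def)
  have E: "(\<lambda>j. a j * w ^ j) sums E w" for w
    unfolding E_def a
    by (rule summable_sums[OF summable_norm_cancel[OF euler_term_summable[OF assms]]])
  have step: "E w = (1 - w) * E (q * w)" for w
  proof -
    have "E w - E (q * w) = w * (- E (q * w))"
    proof (rule powser_q_difference[OF E E])
      show "(\<lambda>j. - (a j * (q * w) ^ j)) sums (- E (q * w))" by (intro sums_minus E)
      fix n
      have "tri (int (Suc n)) = tri (int n) + int n"
        using tri_Suc[of "int n"] by (simp add: add.commute)
      moreover have "1 - q * q ^ n \<noteq> 0" using q_power_Suc_neq_1[OF assms(2), of n] by auto
      ultimately have "a (Suc n) * (1 - q ^ Suc n) = - a n * q ^ n"
        using assms qfac_nonzero[OF assms(2), of n]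
        by (simp add: a_def qfac_Suc power_int_add field_simps)
      moreover have "a (Suc n) * w ^ Suc n - a (Suc n) * (q * w) ^ Suc n
          = (a (Suc n) * (1 - q ^ Suc n)) * w ^ Suc n"
        by (simp add: power_mult_distrib algebra_simps)
      ultimately show "a (Suc n) * w ^ Suc n - a (Suc n) * (q * w) ^ Suc n = w * - (a n * (q * w) ^ n)"
        by (simp add: power_mult_distrib)
    qed auto
    then show ?thesis by (simp add: algebra_simps)
  qed
  have "(\<Prod>i<N. 1 - z * q ^ i) * E (q ^ N * z) = E z" for N
  proof (induction N)
    case (Suc N)
    then show ?case using step[of "q ^ N * z"] by (simp add: mult_ac)
  qed simp
  moreover have "(\<lambda>N. (\<Prod>i<N. 1 - z * q ^ i) * E (q ^ N * z)) \<longlonglongrightarrow> qpoch_inf q z * a 0"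
    by (intro tendsto_mult qpoch_inf_LIMSEQ assms powser_limit_scaled[of 1 a E] E) auto
  ultimately have "E z = qpoch_inf q z * a 0"
    by (simp add: LIMSEQ_const_iff)
  then show ?thesis using E[of z] by (simp add: a) (simp add: a_def)
qed

lemma euler_expansion_has_sum:
  fixes q z :: complex assumes "q \<noteq> 0" "norm q < 1"
  shows "((\<lambda>j::nat. q powi tri (int j) / qfac q j * (- z) ^ j) has_sum qpoch_inf q z) UNIV"
  by (intro norm_summable_imp_has_sum euler_term_summable euler_expansion assms)

lemma recip_term_summable:
  fixes q z :: complex assumes "norm q < 1" "norm z < 1"
  shows "summable (\<lambda>j::nat. norm (1 / qfac q j * z ^ j))"
proof -
  have "summable (\<lambda>j. norm (z ^ j))"
    using assms(2) by (simp add: norm_power summable_geometric)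
  from summable_div_qfac[OF assms(1) this, of "\<lambda>j. j"] show ?thesis by simp
qed

text \<open>The same argument for \<open>(1 - z) E(z) = E(q z)\<close>; the coefficients do
  not decay, so the disc of convergence is the unit disc.\<close>

theorem euler_expansion_recip:
  fixes q z :: complex assumes "q \<noteq> 0" "norm q < 1" "norm z < 1"
  shows "(\<lambda>j::nat. 1 / qfac q j * z ^ j) sums (1 / qpoch_inf q z)"
proof -
  define a where "a j = 1 / qfac q j" for j :: nat
  define E where "E w = (\<Sum>j. a j * w ^ j)" for w
  have E: "(\<lambda>j. a j * w ^ j) sums E w" if "norm w < 1" for w
    unfolding E_def a_def
    by (rule summable_sums[OF summable_norm_cancel[OF recip_term_summable[OF assms(2) that]]])
  have small: "norm (q ^ N * z) < 1" for N
  proof -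
    have "norm (q ^ N * z) \<le> 1 * norm z"
      unfolding norm_mult norm_power using assms by (intro mult_right_mono power_le_one) auto
    then show ?thesis using assms by simp
  qed
  have step: "(1 - w) * E w = E (q * w)" if "norm w < 1" "norm (q * w) < 1" for w
  proof -
    have "E w - E (q * w) = w * E w"
    proof (rule powser_q_difference[OF E E, OF that])
      show "(\<lambda>j. a j * w ^ j) sums E w" by (intro E that)
      fix n
      have "1 - q * q ^ n \<noteq> 0" using q_power_Suc_neq_1[OF assms(2), of n] by auto
      then have "a (Suc n) * (1 - q ^ Suc n) = a n"
        using assms qfac_nonzero[OF assms(2), of n]
        by (simp add: a_def qfac_Suc)
      moreover have "a (Suc n) * w ^ Suc n - a (Suc n) * (q * w) ^ Suc n
          = (a (Suc n) * (1 - q ^ Suc n)) * w ^ Suc n"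
        by (simp add: power_mult_distrib algebra_simps)
      ultimately show "a (Suc n) * w ^ Suc n - a (Suc n) * (q * w) ^ Suc n = w * (a n * w ^ n)"
        by simp
    qed auto
    then show ?thesis by (simp add: algebra_simps)
  qed
  have "(\<Prod>i<N. 1 - z * q ^ i) * E z = E (q ^ N * z)" for N
  proof (induction N)
    case (Suc N)
    have "(1 - q ^ N * z) * E (q ^ N * z) = E (q ^ Suc N * z)"
      using step[of "q ^ N * z"] small[of N] small[of "Suc N"] by (simp add: mult_ac)
    moreover have "(\<Prod>i<Suc N. 1 - z * q ^ i) * E z
        = (1 - q ^ N * z) * ((\<Prod>i<N. 1 - z * q ^ i) * E z)"
      by (simp add: mult_ac)
    ultimately show ?case by (simp only: Suc)
  qed simp
  moreover have "(\<lambda>N. E (q ^ N * z)) \<longlonglongrightarrow> a 0"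
    by (rule powser_limit_scaled[OF E assms(2) zero_less_one])
  ultimately have "(\<lambda>N. (\<Prod>i<N. 1 - z * q ^ i) * E z) \<longlonglongrightarrow> a 0" by simp
  moreover have "(\<lambda>N. (\<Prod>i<N. 1 - z * q ^ i) * E z) \<longlonglongrightarrow> qpoch_inf q z * E z"
    by (rule tendsto_mult[OF qpoch_inf_LIMSEQ[OF assms(2)] tendsto_const])
  ultimately have "qpoch_inf q z * E z = a 0"
    using LIMSEQ_unique by blast
  then have prod1: "qpoch_inf q z * E z = 1" by (simp add: a_def)
  then have "qpoch_inf q z \<noteq> 0" by auto
  then have "E z = 1 / qpoch_inf q z"
    using prod1 by (simp add: nonzero_eq_divide_eq mult.commute)
  then show ?thesis using E[OF assms(3)] by (simp add: a_def)
qed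

section \<open>Theta functions and the Jacobi triple product\<close>

lemma theta_mult_q:
  fixes q z :: complex assumes "q \<noteq> 0" "norm q < 1" "z \<noteq> 0"
  shows "theta q (q * z) = - theta q z / z"
proof -
  have a: "qpoch_inf q z = (1 - z) * qpoch_inf q (q * z)"
    by (rule qpoch_inf_head[OF assms(2)])
  have b: "qpoch_inf q (1 / z) = (1 - 1 / z) * qpoch_inf q (q / z)"
    using qpoch_inf_head[OF assms(2), of "1 / z"] by simp
  show ?thesis
    using assms unfolding theta_def a by (simp add: b field_simps)
qed

lemma theta_inverse:
  fixes q z :: complex assumes "q \<noteq> 0" "norm q < 1" "z \<noteq> 0"
  shows "theta q (1 / z) = - theta q z / z"
proof -
  have "theta q (1 / z) = theta q (q * z)" using assms by (simp add: theta_def mult.commute)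
  then show ?thesis using theta_mult_q[OF assms] by simp
qed

text \<open>Iterating \<open>theta_mult_q\<close> collects the exponents
  \<open>0 + 1 + \<dots> + (k - 1) = tri k\<close>.\<close>

lemma theta_powi_shift:
  fixes q z :: complex assumes "q \<noteq> 0" "norm q < 1" "z \<noteq> 0"
  shows "theta q z = q powi tri k * (- z) powi k * theta q (z * q powi k)"
proof (induction k rule: int_induct[where k = 0])
  case (step1 i)
  have "theta q (z * q powi i) = - (z * q powi i) * theta q (z * q powi (i + 1))"
    using theta_mult_q[of q "z * q powi i"] assms by (simp add: power_int_add mult_ac)
  then have "theta q z = q powi tri i * (- z) powi i * (- (z * q powi i) * theta q (z * q powi (i + 1)))"
    using step1 by simp
  then show ?case
    using assms by (simp only: tri_Suc power_int_add) (simp add: power_int_add)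
next
  case (step2 i)
  define j where "j = i - 1"
  have i: "i = j + 1" by (simp add: j_def)
  have "theta q (z * q powi i) = - theta q (z * q powi j) / (z * q powi j)"
    using theta_mult_q[of q "z * q powi j"] assms by (simp add: i power_int_add mult_ac)
  moreover have "theta q z = q powi tri j * q powi j * ((- z) powi j * (- z)) * theta q (z * q powi i)"
    using step2 assms by (simp add: i tri_Suc power_int_add)
  ultimately have "theta q z = q powi tri j * (- z) powi j * theta q (z * q powi j)"
    using assms by simp
  then show ?case by (simp add: j_def)
qed (use assms in auto)

lemma theta_nonzero:
  fixes q z :: complex assumes "q \<noteq> 0" "norm q < 1" "z \<notin> qint_powers q"
  shows "theta q z \<noteq> 0"
proof -
  have "1 / z * q powi 1 \<notin> qint_powers q"
    using assms qint_powers_mult_iff qint_powers_inverse_iff by metis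
  then have "q / z \<notin> qint_powers q" by simp
  then show ?thesis using assms by (simp add: theta_def qpoch_inf_nonzero_generic)
qed

lemma has_sum_product:
  fixes u :: "'a \<Rightarrow> complex" and v :: "'b \<Rightarrow> complex"
  assumes u: "(\<lambda>n. norm (u n)) summable_on UNIV" and v: "(\<lambda>j. norm (v j)) summable_on UNIV"
    and U: "(u has_sum U) UNIV" and V: "(v has_sum V) UNIV"
  shows "((\<lambda>(n, j). u n * v j) has_sum (U * V)) (UNIV \<times> UNIV)"
proof -
  define F where "F = (\<lambda>(n, j). u n * v j)"
  have "(\<lambda>p. norm (F p)) summable_on (UNIV \<times> UNIV)"
  proof (subst Infinite_Sum.abs_summable_on_Sigma_iff, intro conjI ballI)
    fix n
    show "(\<lambda>j. norm (F (n, j))) summable_on UNIV"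
      using summable_on_cmult_right[OF v, of "norm (u n)"] by (simp add: F_def norm_mult)
  next
    have "infsum (\<lambda>j. norm (F (n, j))) UNIV = norm (u n) * infsum (\<lambda>j. norm (v j)) UNIV" for n
      unfolding F_def by (simp add: norm_mult infsum_cmult_right')
    then show "(\<lambda>n. norm (infsum (\<lambda>j. norm (F (n, j))) UNIV)) summable_on UNIV"
      using summable_on_cmult_left[OF u, of "norm (infsum (\<lambda>j. norm (v j)) UNIV)"]
      by (simp add: norm_mult abs_mult)
  qed
  then have summ: "F summable_on (UNIV \<times> UNIV)" by (rule abs_summable_summable)
  have "(F has_sum (U * V)) (UNIV \<times> UNIV)"
    by (rule has_sum_SigmaI[OF _ has_sum_cmult_left[OF U, of V] summ])
       (use has_sum_cmult_right[OF V] in \<open>simp add: F_def\<close>)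
  then show ?thesis by (simp add: F_def)
qed

text \<open>A Cauchy-product rule: a double series whose terms become a product after a shift of
  the bilateral index sums to the product of two series. It is used three times, each time with
  Euler's expansion as the inner sum.\<close>

lemma has_sum_shifted_product:
  fixes u :: "int \<Rightarrow> complex" and v :: "nat \<Rightarrow> complex" and h :: "nat \<Rightarrow> int"
  assumes u: "(\<lambda>n. norm (u n)) summable_on UNIV" and v: "summable (\<lambda>j. norm (v j))"
    and U: "(u has_sum U) UNIV" and V: "v sums V"
    and inner: "\<And>k. ((\<lambda>j. u (k + h j) * v j) has_sum g k) UNIV"
  shows "(g has_sum (U * V)) UNIV"
proof -
  define F where "F = (\<lambda>(n, j). u n * v j)"
  have V': "(v has_sum V) UNIV" by (rule norm_summable_imp_has_sum[OF v V])
  have v': "(\<lambda>j. norm (v j)) summable_on UNIV"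
    using v by (intro norm_summable_imp_summable_on) simp
  have "(F has_sum (U * V)) (UNIV \<times> UNIV)"
    unfolding F_def by (rule has_sum_product[OF u v' U V'])
  \<comment> \<open>The shear \<open>(k, j) \<mapsto> (k + h j, j)\<close> permutes the index set.\<close>
  moreover have "((\<lambda>(k, j). u (k + h j) * v j) has_sum (U * V)) (UNIV \<times> UNIV)
      \<longleftrightarrow> (F has_sum (U * V)) (UNIV \<times> UNIV)"
    by (rule has_sum_reindex_bij_witness[where i = "\<lambda>(n, j). (n - h j, j)" and j = "\<lambda>(k, j). (k + h j, j)"])
       (auto simp: F_def)
  ultimately have "((\<lambda>(k, j). u (k + h j) * v j) has_sum (U * V)) (UNIV \<times> UNIV)" by blast
  then show ?thesis
    by (rule has_sum_SigmaD) (use inner in simp)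
qed

text \<open>Multiply \<open>(z)\<^sub>\<infinity> (q)\<^sub>\<infinity>\<close> out by Euler's
  first expansion, writing \<open>(q)\<^sub>\<infinity> / (q)\<^sub>n\<close> as
  \<open>(q\<^sup>n\<^sup>+\<^sup>1)\<^sub>\<infinity>\<close>. This makes sense for every integer
  n, so that the sum becomes bilateral; expanding the new factor by Euler again and shifting the
  index separates the bilateral theta series from
  \<open>1 / (q / z)\<^sub>\<infinity>\<close>.\<close>

lemma jacobi_triple_product_outside:
  fixes q z :: complex assumes "q \<noteq> 0" "norm q < 1" "norm z > norm q"
  shows "theta_series q (- z) = qpoch_inf q q * theta q z"
proof -
  have z: "z \<noteq> 0" using assms by auto
  have qz: "norm (q / z) < 1" using assms z by (simp add: norm_divide)
  \<comment> \<open>With these factors \<open>u (k + j) * v j\<close> is, up to a factor depending on k only, the j-th term of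
    the Euler expansion of \<open>(q\<^sup>k\<^sup>+\<^sup>1)\<^sub>\<infinity>\<close>.\<close>
  define u where "u n = q powi tri n * (- z) powi n" for n :: int
  define v where "v j = 1 / qfac q j * (q / z) ^ j" for j :: nat
  define g where "g n = u n * qpoch_inf q (q powi (n + 1))" for n :: int
  have inner: "((\<lambda>j. u (k + int j) * v j) has_sum g k) UNIV" for k
  proof -
    have "u (k + int j) * v j
        = u k * (q powi tri (int j) / qfac q j * (- (q powi (k + 1))) ^ j)" for j
    proof -
      have "q powi (k * int j) = (q powi k) ^ j" using power_int_mult[of q k "int j"] by simp
      moreover have "(- z) ^ j * (q / z) ^ j = (- 1) ^ j * q ^ j"
        using z by (simp flip: power_mult_distrib)
      moreover have "(- (q powi k * q)) ^ j = (- 1) ^ j * (q powi k) ^ j * q ^ j"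
        by (simp flip: power_mult_distrib)
      ultimately show ?thesis using assms z
        by (simp add: u_def v_def tri_add power_int_add)
    qed
    then show ?thesis unfolding g_def
      using has_sum_cmult_right[OF euler_expansion_has_sum[OF assms(1,2), of "q powi (k + 1)"], of "u k"]
      by simp
  qed
  have "(g has_sum (theta_series q (- z) * (1 / qpoch_inf q (q / z)))) UNIV"
  proof (rule has_sum_shifted_product[OF _ _ _ _ inner])
    show "(\<lambda>n. norm (u n)) summable_on UNIV" "(u has_sum theta_series q (- z)) UNIV"
      unfolding u_def using assms z by (intro theta_series_summable theta_series_has_sum; simp)+
    show "summable (\<lambda>j. norm (v j))" "v sums (1 / qpoch_inf q (q / z))"
      unfolding v_def using assms qz by (intro recip_term_summable euler_expansion_recip; simp)+
  qed
  moreover have "(g has_sum (qpoch_inf q q * qpoch_inf q z)) UNIV"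
  proof -
    \<comment> \<open>Terms of nonnegative index form the Euler expansion of \<open>(z)\<^sub>\<infinity>\<close>; the others vanish because
      \<open>(q\<^sup>n\<^sup>+\<^sup>1)\<^sub>\<infinity>\<close> contains the factor 0.\<close>
    have gn: "g (int j) = qpoch_inf q q * (q powi tri (int j) / qfac q j * (- z) ^ j)" for j
    proof -
      have "q powi (int j + 1) = q ^ Suc j" using assms(1) by (simp add: power_int_add)
      then have "qpoch_inf q q = qfac q j * qpoch_inf q (q powi (int j + 1))"
        using qpoch_inf_qfac[OF assms(2), of j] by simp
      then show ?thesis using qfac_nonzero[OF assms(2), of j] by (simp add: g_def u_def)
    qed
    have g0: "g n = 0" if "n < 0" for n
    proof -
      define m where "m = nat (- n - 1)"
      have "n + 1 = - int m" using that by (simp add: m_def)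
      then have "q powi (n + 1) * q ^ m = 1" using assms(1) by (simp add: power_int_minus)
      then show ?thesis using qpoch_inf_eq_0[OF assms(2)] by (simp add: g_def)
    qed
    have "((\<lambda>j. g (int j)) has_sum (qpoch_inf q q * qpoch_inf q z)) UNIV"
      unfolding gn by (intro has_sum_cmult_right euler_expansion_has_sum assms)
    then have "(g has_sum (qpoch_inf q q * qpoch_inf q z)) (range int)"
      by (subst has_sum_reindex) (auto simp: o_def)
    then show ?thesis
    proof (rule has_sum_cong_neutral[THEN iffD1, rotated -1])
      fix n :: int assume "n \<in> UNIV - range int"
      then have "n < 0" by (metis DiffE nonneg_int_cases not_less rangeI)
      then show "g n = 0" by (rule g0)
    qed auto
  qed
  ultimately have "theta_series q (- z) * (1 / qpoch_inf q (q / z)) = qpoch_inf q q * qpoch_inf q z"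
    by (rule has_sum_unique)
  moreover have "qpoch_inf q (q / z) \<noteq> 0"
  proof (rule qpoch_inf_nonzero[OF assms(2)])
    fix n
    have "norm (q / z * q ^ n) < 1 * 1"
      unfolding norm_mult[of "q / z"] norm_power using qz assms by (intro mult_less_le_imp_less power_le_one) auto
    then show "1 \<noteq> q / z * q ^ n" by auto
  qed
  ultimately show ?thesis by (simp add: theta_def field_simps)
qed

text \<open>Both sides change by the same factor under \<open>z \<mapsto> q z\<close>, which
  carries the identity from \<open>norm z > norm q\<close> to all nonzero z.\<close>

theorem jacobi_triple_product:
  fixes q z :: complex assumes "q \<noteq> 0" "norm q < 1" "z \<noteq> 0"
  shows "theta_series q (- z) = qpoch_inf q q * theta q z"
proof -
  have *: "theta_series q (- z) = qpoch_inf q q * theta q z" if "norm z > norm q ^ Suc n" "z \<noteq> 0" for z n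
    using that
  proof (induction n arbitrary: z)
    case 0
    then show ?case using jacobi_triple_product_outside[OF assms(1,2)] by simp
  next
    case (Suc n)
    have "norm (z / q) > norm q ^ Suc n"
      using Suc.prems assms by (simp add: norm_divide field_simps)
    then have "theta_series q (- (z / q)) = qpoch_inf q q * theta q (z / q)"
      using Suc assms by simp
    then show ?case
      using theta_series_mult_q[OF assms(1,2), of "- (z / q)"] theta_mult_q[OF assms(1,2), of "z / q"]
        assms Suc.prems by simp
  qed
  have "(\<lambda>n. norm q ^ Suc n) \<longlonglongrightarrow> 0"
    by (rule LIMSEQ_Suc, rule LIMSEQ_power_zero) (use assms in simp)
  then have "eventually (\<lambda>n. norm q ^ Suc n < norm z) sequentially"
    by (rule order_tendstoD) (use assms in simp)
  then obtain n where "norm q ^ Suc n < norm z" by (auto simp: eventually_sequentially)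
  then show ?thesis using * assms(3) by blast
qed

section \<open>The bilateral series of the little \<open>\<mu>\<close>-function\<close>

lemma qpoch_inf_power_limit:
  fixes q x :: complex assumes "q \<noteq> 0" "norm q < 1" "x \<notin> qint_powers q"
  shows "(\<lambda>n. qpoch_inf q (x * q ^ n)) \<longlonglongrightarrow> 1"
proof -
  have nz: "qpoch_inf q x \<noteq> 0" by (rule qpoch_inf_nonzero_generic[OF assms])
  have split: "qpoch_inf q x = (\<Prod>i<n. 1 - x * q ^ i) * qpoch_inf q (x * q ^ n)" for n
    using qpoch_inf_split[OF assms(2), of x n] by (simp add: mult.commute)
  have "qpoch_inf q (x * q ^ n) = qpoch_inf q x / (\<Prod>i<n. 1 - x * q ^ i)" for n
  proof -
    have "(\<Prod>i<n. 1 - x * q ^ i) \<noteq> 0" using split[of n] nz by auto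
    then show ?thesis using split[of n] by (simp add: nonzero_eq_divide_eq mult.commute)
  qed
  moreover have "(\<lambda>n. qpoch_inf q x / (\<Prod>i<n. 1 - x * q ^ i)) \<longlonglongrightarrow> qpoch_inf q x / qpoch_inf q x"
    by (rule tendsto_divide[OF tendsto_const qpoch_inf_LIMSEQ[OF assms(2)] nz])
  ultimately show ?thesis using nz by simp
qed

text \<open>The uniform bound that makes all bilateral sums below converge and allows limits to be
  taken termwise: \<open>(x q\<^sup>k)\<^sub>\<infinity>\<close> tends to 1 for large k, and for
  k tending to \<open>-\<infinity>\<close> its modulus eventually does not decrease.\<close>

lemma inverse_qpoch_inf_bounded:
  fixes q x :: complex assumes "q \<noteq> 0" "norm q < 1" "x \<notin> qint_powers q"
  obtains C where "\<And>k::int. norm (1 / qpoch_inf q (x * q powi k)) \<le> C"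
proof -
  have nz: "qpoch_inf q (x * q powi k) \<noteq> 0" for k
    using assms by (simp add: qpoch_inf_nonzero_generic qint_powers_mult_iff)
  have "(\<lambda>n. 1 / qpoch_inf q (x * q ^ n)) \<longlonglongrightarrow> 1 / 1"
    by (rule tendsto_divide[OF tendsto_const qpoch_inf_power_limit[OF assms]]) simp
  then have "Bseq (\<lambda>n. 1 / qpoch_inf q (x * q ^ n))"
    by (intro convergent_imp_Bseq convergentI)
  then obtain C1 where C1: "\<And>n. norm (1 / qpoch_inf q (x * q ^ n)) \<le> C1"
    unfolding Bseq_def by blast
  define b where "b j = 1 / qpoch_inf q (x * q powi (- int j))" for j
  obtain C2 where C2: "\<And>j. norm (b j) \<le> C2"
  proof (cases "x = 0")
    case True
    then show ?thesis using that[of "norm (b 0)"] by (simp add: b_def)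
  next
    case False
    \<comment> \<open>Going down in the exponent multiplies the reciprocal by \<open>1 / (1 - x q\<^sup>-\<^sup>j\<^sup>-\<^sup>1)\<close>, which has modulus
      at most 1 as soon as \<open>norm q ^ Suc j < norm x / 2\<close>.\<close>
    have step: "b j = b (Suc j) * (1 - x * q powi (- int (Suc j)))" for j
    proof -
      have "q * (x * q powi (- int (Suc j))) = x * q powi (- int j)"
        using power_int_add_1[of q "- int (Suc j)"] assms(1) by (simp add: mult_ac)
      then have "qpoch_inf q (x * q powi (- int (Suc j)))
          = (1 - x * q powi (- int (Suc j))) * qpoch_inf q (x * q powi (- int j))"
        using qpoch_inf_head[OF assms(2), of "x * q powi (- int (Suc j))"] by (simp only:)
      then show ?thesis
        using nz[of "- int j"] nz[of "- int (Suc j)"] unfolding b_def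
        by (simp only: field_simps) simp
    qed
    have "(\<lambda>j. norm q ^ Suc j) \<longlonglongrightarrow> 0"
      by (rule LIMSEQ_Suc, rule LIMSEQ_power_zero) (use assms in simp)
    then have "eventually (\<lambda>j. norm q ^ Suc j < norm x / 2) sequentially"
      by (rule order_tendstoD) (use False in simp)
    then obtain J where J: "\<And>j. j \<ge> J \<Longrightarrow> norm q ^ Suc j < norm x / 2"
      by (auto simp: eventually_sequentially)
    have "norm (b (j + J)) \<le> norm (b J)" for j
    proof (induction j)
      case (Suc j)
      have "norm (x * q powi (- int (Suc (j + J)))) = norm x / norm q ^ Suc (j + J)"
        unfolding power_int_minus norm_mult norm_inverse power_int_of_nat norm_power
        by (simp only: divide_inverse)
      also have "\<dots> \<ge> 2"
      proof -
        have "norm q ^ Suc (j + J) > 0" using assms(1) by simp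
        then show ?thesis using J[of "j + J"] by (simp only: pos_le_divide_eq) linarith
      qed
      finally have "norm (1 - x * q powi (- int (Suc (j + J)))) \<ge> 1"
        using norm_triangle_ineq2[of "x * q powi (- int (Suc (j + J)))" 1]
          norm_minus_commute[of "x * q powi (- int (Suc (j + J)))" 1] by (simp only: norm_one)
      then have "norm (b (Suc (j + J))) * 1 \<le> norm (b (Suc (j + J))) * norm (1 - x * q powi (- int (Suc (j + J))))"
        by (intro mult_left_mono) auto
      also have "\<dots> = norm (b (j + J))" by (subst step[of "j + J"]) (rule norm_mult[symmetric])
      finally show ?case using Suc by simp
    qed simp
    then have "Bseq (\<lambda>j. b (j + J))" by (intro BseqI') 
    then have "Bseq b" by (rule Bseq_offset)
    then show ?thesis using that unfolding Bseq_def by blast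
  qed
  show ?thesis
  proof (rule that[of "max C1 C2"])
    fix k :: int
    show "norm (1 / qpoch_inf q (x * q powi k)) \<le> max C1 C2"
    proof (cases k rule: int_cases2)
      case (nonneg n)
      then show ?thesis using C1[of n] by (simp add: le_max_iff_disj)
    next
      case (nonpos n)
      then show ?thesis using C2[of n] by (simp add: le_max_iff_disj b_def)
    qed
  qed
qed

text \<open>The bilateral series of the little \<open>\<mu>\<close>-function divided by
  \<open>(x)\<^sub>\<infinity>\<close>. The quotient
  \<open>(x)\<^sub>k / (x)\<^sub>\<infinity>\<close> is
  \<open>1 / (x q\<^sup>k)\<^sub>\<infinity>\<close>, so the dependence on x is only through
  \<open>x q\<^sup>k\<close> and shifting x by q shifts the index.\<close>

definition mu_sum :: "complex \<Rightarrow> complex \<Rightarrow> complex \<Rightarrow> complex" where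
  "mu_sum q x y = (\<Sum>\<^sub>\<infinity>k::int. q powi tri k * (- 1 / y) powi k / qpoch_inf q (x * q powi k))"

lemma mu_sum_has_sum:
  fixes q x y :: complex assumes "q \<noteq> 0" "norm q < 1" "x \<notin> qint_powers q" "y \<noteq> 0"
  shows "((\<lambda>k::int. q powi tri k * (- 1 / y) powi k / qpoch_inf q (x * q powi k)) has_sum mu_sum q x y) UNIV"
proof -
  obtain C where C: "\<And>k::int. norm (1 / qpoch_inf q (x * q powi k)) \<le> C"
    using inverse_qpoch_inf_bounded[OF assms(1-3)] by blast
  have "(\<lambda>k::int. norm (q powi tri k * (- 1 / y) powi k / qpoch_inf q (x * q powi k))) summable_on UNIV"
  proof (rule Infinite_Sum.abs_summable_on_comparison_test')
    show "(\<lambda>k::int. norm (q powi tri k * (- 1 / y) powi k) * C) summable_on UNIV"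
      by (intro summable_on_cmult_left theta_series_summable) (use assms in auto)
    fix k :: int
    show "norm (q powi tri k * (- 1 / y) powi k / qpoch_inf q (x * q powi k))
        \<le> norm (q powi tri k * (- 1 / y) powi k) * C"
      using mult_left_mono[OF C[of k] norm_ge_zero, of "q powi tri k * (- 1 / y) powi k"]
      by (simp add: norm_mult norm_divide)
  qed
  then have "(\<lambda>k::int. q powi tri k * (- 1 / y) powi k / qpoch_inf q (x * q powi k)) summable_on UNIV"
    by (rule abs_summable_summable)
  then show ?thesis unfolding mu_sum_def by (rule has_sum_infsum)
qed

text \<open>Since
  \<open>1 / (x q\<^sup>k\<^sup>+\<^sup>1)\<^sub>\<infinity> = (1 - x q\<^sup>k) / (x q\<^sup>k)\<^sub>\<infinity>\<close>,
  replacing x by \<open>x q\<close> adds a second series; its factor \<open>q\<^sup>k\<close>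
  turns \<open>tri k\<close> into \<open>tri (k + 1)\<close>, so that it is the series at
  \<open>x / q\<close>.\<close>

lemma mu_sum_recurrence:
  fixes q x y :: complex assumes "q \<noteq> 0" "norm q < 1" "x \<notin> qint_powers q" "y \<noteq> 0"
  shows "mu_sum q (x * q) y = mu_sum q x y + x * y * mu_sum q (x / q) y"
proof -
  define T where "T x k = q powi tri k * (- 1 / y) powi k / qpoch_inf q (x * q powi k)" for x and k :: int
  have xq: "x * q \<notin> qint_powers q" "x / q \<notin> qint_powers q"
    using qint_powers_mult_iff[OF assms(1), of x 1] qint_powers_mult_iff[OF assms(1), of x "-1"] assms(3)
    by (simp_all add: power_int_minus divide_inverse)
  have S: "(T w has_sum mu_sum q w y) UNIV" if "w \<notin> qint_powers q" for w
    unfolding T_def using mu_sum_has_sum[OF assms(1,2) that assms(4)] .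
  have termwise: "T (x * q) k = T x k + x * y * T (x / q) (k + 1)" for k
  proof -
    have nz: "qpoch_inf q (x * q powi k * q) \<noteq> 0"
      using qpoch_inf_nonzero_generic[OF assms(1,2), of "x * q powi (k + 1)"]
        qint_powers_mult_iff[OF assms(1), of x "k + 1"] assms(1,3) by (simp add: power_int_add mult_ac)
    have nz': "qpoch_inf q (x * q powi k) \<noteq> 0"
      using qpoch_inf_nonzero_generic[OF assms(1,2), of "x * q powi k"]
        qint_powers_mult_iff[OF assms(1), of x k] assms(1,3) by simp
    have "qpoch_inf q (x * q powi k) = (1 - x * q powi k) * qpoch_inf q (x * q powi k * q)"
      using qpoch_inf_head[OF assms(2), of "x * q powi k"] by (simp add: mult.commute)
    then have inv: "1 / qpoch_inf q (x * q powi k * q) = (1 - x * q powi k) / qpoch_inf q (x * q powi k)"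
      using nz nz' by (simp add: field_simps)
    have "T (x * q) k = q powi tri k * (- 1 / y) powi k * (1 / qpoch_inf q (x * q powi k * q))"
      by (simp add: T_def mult_ac)
    also have "\<dots> = q powi tri k * (- 1 / y) powi k * ((1 - x * q powi k) / qpoch_inf q (x * q powi k))"
      by (simp only: inv)
    also have "\<dots> = T x k + q powi tri k * (- 1 / y) powi k * (- x * q powi k / qpoch_inf q (x * q powi k))"
      by (simp add: T_def diff_divide_distrib algebra_simps)
    also have "q powi tri k * (- 1 / y) powi k * (- x * q powi k / qpoch_inf q (x * q powi k))
        = x * y * T (x / q) (k + 1)"
      using assms by (simp add: T_def tri_Suc power_int_add)
    finally show ?thesis .
  qed
  have "(T (x / q) has_sum mu_sum q (x / q) y) UNIV" by (rule S[OF xq(2)])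
  moreover have "((\<lambda>k. T (x / q) (k + 1)) has_sum mu_sum q (x / q) y) UNIV
     \<longleftrightarrow> (T (x / q) has_sum mu_sum q (x / q) y) UNIV"
    by (rule has_sum_reindex_bij_witness[where i = "\<lambda>n. n - 1" and j = "\<lambda>n. n + 1"]) auto
  ultimately have "((\<lambda>k. T (x / q) (k + 1)) has_sum mu_sum q (x / q) y) UNIV" by blast
  then have "((\<lambda>k. T x k + x * y * T (x / q) (k + 1)) has_sum (mu_sum q x y + x * y * mu_sum q (x / q) y)) UNIV"
    by (intro has_sum_add S assms has_sum_cmult_right)
  then have "(T (x * q) has_sum (mu_sum q x y + x * y * mu_sum q (x / q) y)) UNIV"
    by (simp add: termwise[abs_def])
  then show ?thesis using has_sum_unique[OF S[OF xq(1)]] by blast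
qed

text \<open>Dominated convergence: the reciprocals
  \<open>1 / (x q\<^sup>n\<^sup>+\<^sup>k)\<^sub>\<infinity>\<close> are bounded uniformly in k
  and n and tend to 1.\<close>

lemma mu_sum_limit:
  fixes q x y :: complex assumes "q \<noteq> 0" "norm q < 1" "x \<notin> qint_powers q" "y \<noteq> 0"
  shows "(\<lambda>n. mu_sum q (x * q ^ n) y) \<longlonglongrightarrow> theta_series q (- 1 / y)"
proof -
  define f where "f k n = q powi tri k * (- 1 / y) powi k / qpoch_inf q (x * q ^ n * q powi k)" for k :: int and n :: nat
  obtain C where C: "\<And>k::int. norm (1 / qpoch_inf q (x * q powi k)) \<le> C"
    using inverse_qpoch_inf_bounded[OF assms(1-3)] by blast
  have unif: "uniform_limit UNIV (\<lambda>X n. \<Sum>k\<in>X. f k n) (\<lambda>n. \<Sum>\<^sub>\<infinity>k. f k n) (finite_subsets_at_top UNIV)"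
  proof (rule Weierstrass_m_test_general)
    show "(\<lambda>k::int. norm (q powi tri k * (- 1 / y) powi k) * C) summable_on UNIV"
      by (intro summable_on_cmult_left theta_series_summable) (use assms in auto)
    fix k :: int and n :: nat
    have "f k n = q powi tri k * (- 1 / y) powi k * (1 / qpoch_inf q (x * q powi (int n + k)))"
      using assms(1) by (simp add: f_def power_int_add mult_ac)
    then show "norm (f k n) \<le> norm (q powi tri k * (- 1 / y) powi k) * C"
      using mult_left_mono[OF C[of "int n + k"] norm_ge_zero, of "q powi tri k * (- 1 / y) powi k"]
      by (simp only: norm_mult)
  qed
  have partial: "((\<lambda>X. \<Sum>k\<in>X. q powi tri k * (- 1 / y) powi k) \<longlongrightarrow> theta_series q (- 1 / y)) (finite_subsets_at_top UNIV)"
    using theta_series_has_sum[OF assms(1,2), of "- 1 / y"] assms(4) by (simp add: has_sum_def)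
  have termwise: "\<forall>\<^sub>F X in finite_subsets_at_top UNIV.
      ((\<lambda>n. \<Sum>k\<in>X. f k n) \<longlongrightarrow> (\<Sum>k\<in>X. q powi tri k * (- 1 / y) powi k)) sequentially"
  proof (intro always_eventually allI tendsto_sum)
    fix k :: int
    have "(\<lambda>n. qpoch_inf q (x * q powi k * q ^ n)) \<longlonglongrightarrow> 1"
      by (rule qpoch_inf_power_limit) (use assms qint_powers_mult_iff in auto)
    then have "(\<lambda>n. q powi tri k * (- 1 / y) powi k / qpoch_inf q (x * q powi k * q ^ n))
        \<longlonglongrightarrow> q powi tri k * (- 1 / y) powi k / 1"
      by (intro tendsto_divide tendsto_const) auto
    then show "f k \<longlonglongrightarrow> q powi tri k * (- 1 / y) powi k"
      by (simp add: f_def[abs_def] mult_ac)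
  qed
  have "((\<lambda>n. \<Sum>\<^sub>\<infinity>k. f k n) \<longlongrightarrow> theta_series q (- 1 / y)) sequentially"
    by (rule swap_uniform_limit'[OF termwise partial unif]) auto
  then show ?thesis by (simp add: mu_sum_def f_def)
qed

lemma little_mu_eq_mu_sum:
  fixes q x y \<tau> :: complex
  assumes "q = nome \<tau>" "q \<noteq> 0" "norm q < 1" "x \<notin> qint_powers q"
  shows "little_mu \<tau> x y = \<i> * qpow \<tau> (- 1 / 8) / (qpoch_inf q q * theta q (q * y)) * mu_sum q x y"
proof -
  have nz: "qpoch_inf q x \<noteq> 0" by (rule qpoch_inf_nonzero_generic[OF assms(2-4)])
  have "qpoch q x n * (- 1) powi n * q powi (n * (n - 1) div 2) * (1 / y) powi n
      = qpoch_inf q x * (q powi tri n * (- 1 / y) powi n / qpoch_inf q (x * q powi n))" for n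
  proof -
    have "- 1 / y = (- 1) * (1 / y)" by simp
    then have "(- 1 / y) powi n = (- 1) powi n * (1 / y) powi n"
      by (simp only: power_int_mult_distrib)
    then show ?thesis by (simp add: qpoch_def tri_def)
  qed
  then have "psi12 q x (1 / y) = qpoch_inf q x * mu_sum q x y"
    unfolding psi12_def mu_sum_def by (simp only: infsum_cmult_right')
  then show ?thesis using nz assms(1) by (simp add: little_mu_def Let_def)
qed

section \<open>The series \<open>\<^sub>0\<phi>\<^sub>1\<close>\<close>

lemma phi01_term_summable:
  fixes q z :: complex assumes "q \<noteq> 0" "norm q < 1"
  shows "summable (\<lambda>n. norm (q powi (2 * tri (int n)) / qfac q n * z ^ n))"
proof -
  have q2: "q powi (2 * k) = (q ^ 2) powi k" for k using power_int_mult[of q 2 k] by simp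
  have "summable (\<lambda>n. norm ((q ^ 2) powi tri (int n) * z ^ n))"
    using assms by (intro theta_series_norm_summable_nat) (auto simp: norm_power power_less_one_iff)
  from summable_div_qfac[OF assms(2) this, of "\<lambda>n. n"] show ?thesis by (simp add: q2)
qed

lemma phi01_sums:
  fixes q z :: complex assumes "q \<noteq> 0" "norm q < 1"
  shows "(\<lambda>n. q powi (2 * tri (int n)) / qfac q n * z ^ n) sums phi01 q z"
proof -
  have e: "q ^ (n * (n - 1)) = q powi (2 * tri (int n))" for n
  proof -
    have "int (n * (n - 1)) = 2 * tri (int n)" by (cases n) (simp_all add: two_tri algebra_simps)
    then show ?thesis by (metis power_int_of_nat)
  qed
  show ?thesis
    unfolding phi01_def e qpoch_eq_qfac[OF assms(2)]
    by (rule summable_sums[OF summable_norm_cancel[OF phi01_term_summable[OF assms]]])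
qed

lemma phi01_recurrence:
  fixes q z :: complex assumes "q \<noteq> 0" "norm q < 1"
  shows "phi01 q z - phi01 q (q * z) = z * phi01 q (q ^ 2 * z)"
proof (rule powser_q_difference[OF phi01_sums[OF assms] phi01_sums[OF assms] _ _ phi01_sums[OF assms]])
  fix n
  have "1 - q * q ^ n \<noteq> 0" using q_power_Suc_neq_1[OF assms(2), of n] by auto
  moreover have "2 * tri (int (Suc n)) = 2 * tri (int n) + 2 * int n"
    using tri_Suc[of "int n"] by (simp add: add.commute)
  then have "q powi (2 * tri (int (Suc n))) = q powi (2 * tri (int n)) * (q ^ 2) ^ n"
    using assms(1) by (simp add: power_int_add power_int_mult)
  ultimately have "q powi (2 * tri (int (Suc n))) / qfac q (Suc n) * (1 - q ^ Suc n)
      = q powi (2 * tri (int n)) / qfac q n * (q ^ 2) ^ n"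
    using qfac_nonzero[OF assms(2), of n] by (simp add: qfac_Suc)
  note coeff = this
  have "A * z ^ m - A * (q * z) ^ m = A * (1 - q ^ m) * z ^ m" for A m
    by (simp add: power_mult_distrib algebra_simps)
  then have "q powi (2 * tri (int (Suc n))) / qfac q (Suc n) * z ^ Suc n
      - q powi (2 * tri (int (Suc n))) / qfac q (Suc n) * (q * z) ^ Suc n
      = q powi (2 * tri (int (Suc n))) / qfac q (Suc n) * (1 - q ^ Suc n) * z ^ Suc n" .
  also have "\<dots> = q powi (2 * tri (int n)) / qfac q n * (q ^ 2) ^ n * z ^ Suc n"
    by (simp only: coeff)
  also have "\<dots> = z * (q powi (2 * tri (int n)) / qfac q n * (q ^ 2 * z) ^ n)"
    unfolding power_mult_distrib by (simp add: mult_ac)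
  finally show "q powi (2 * tri (int (Suc n))) / qfac q (Suc n) * z ^ Suc n
      - q powi (2 * tri (int (Suc n))) / qfac q (Suc n) * (q * z) ^ Suc n
      = z * (q powi (2 * tri (int n)) / qfac q n * (q ^ 2 * z) ^ n)" .
qed auto

lemma phi01_limit:
  fixes q z :: complex assumes "q \<noteq> 0" "norm q < 1"
  shows "(\<lambda>n. phi01 q (q ^ n * z)) \<longlonglongrightarrow> 1"
  using powser_limit_scaled[where r = 1 and f = "phi01 q", OF phi01_sums[OF assms] assms(2), of z] by simp

section \<open>Casoratians of the Fibonacci recurrence\<close>

text \<open>Solutions are determined by their values at 0 and 1; the sequences S and T are the
  basis dual to these values.\<close>

lemma qt_fib_solution:
  assumes "t \<noteq> 0" "q \<noteq> 0" "qt_fib_rec t q F"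
  shows "F n = F 1 * fibS n t q + F 0 * fibT (n - 1) t q"
proof -
  define S where "S = (THE F. qt_fib_rec t q F \<and> F 0 = 0 \<and> F 1 = 1)"
  define T where "T = (THE F. qt_fib_rec t q F \<and> F 0 = 1 \<and> F 1 = 0)"
  have S: "qt_fib_rec t q S \<and> S 0 = 0 \<and> S 1 = 1"
    unfolding S_def by (rule theI'[OF qt_fib_unique_solution[OF assms(1,2)]])
  have T: "qt_fib_rec t q T \<and> T 0 = 1 \<and> T 1 = 0"
    unfolding T_def by (rule theI'[OF qt_fib_unique_solution[OF assms(1,2)]])
  define G where "G n = F 1 * S n + F 0 * T n" for n
  have "qt_fib_rec t q G"
    unfolding qt_fib_rec_def
  proof
    fix n
    have Sn: "S n = S (n - 1) + t * q powi (n - 2) * S (n - 2)"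
      using S unfolding qt_fib_rec_def by blast
    have Tn: "T n = T (n - 1) + t * q powi (n - 2) * T (n - 2)"
      using T unfolding qt_fib_rec_def by blast
    show "G n = G (n - 1) + t * q powi (n - 2) * G (n - 2)"
      unfolding G_def by (subst Sn, subst Tn) (simp add: algebra_simps)
  qed
  moreover have "G 0 = F 0" "G 1 = F 1" using S T by (simp_all add: G_def)
  moreover obtain K where K: "\<And>L. qt_fib_rec t q L \<and> L 0 = F 0 \<and> L 1 = F 1 \<Longrightarrow> L = K"
    using qt_fib_unique_solution[OF assms(1,2), of "F 0" "F 1"] by (rule ex1E) blast
  ultimately have "G = K" "F = K" using K[of G] K[of F] assms(3) by simp_all
  then have "F n = G n" by simp
  then have "F n = F 1 * S n + F 0 * T n" by (simp only: G_def)
  then show ?thesis unfolding fibS_def fibT_def S_def[symmetric] T_def[symmetric] by simp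
qed

text \<open>An antisymmetric form on the two-dimensional solution space is determined by one
  value.\<close>

lemma casorati_eq:
  assumes "t \<noteq> 0" "q \<noteq> 0" "qt_fib_rec t q F" "qt_fib_rec t q G"
  shows "F n * G m - F m * G n
    = (F 0 * G 1 - F 1 * G 0) * (fibS m t q * fibT (n - 1) t q - fibS n t q * fibT (m - 1) t q)"
  unfolding qt_fib_solution[OF assms(1-3), of n] qt_fib_solution[OF assms(1-3), of m]
     qt_fib_solution[OF assms(1,2,4), of n] qt_fib_solution[OF assms(1,2,4), of m]
  by (simp only: algebra_simps)

lemma casorati_step:
  assumes "qt_fib_rec t q F" "qt_fib_rec t q G"
  shows "F (n + 1) * G (n + 2) - F (n + 2) * G (n + 1) = - t * q powi n * (F n * G (n + 1) - F (n + 1) * G n)"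
proof -
  have *: "H (n + 2) = H (n + 1) + t * q powi n * H n" if "qt_fib_rec t q H" for H
  proof -
    have "n + 2 - 1 = n + 1" "n + 2 - 2 = n" by auto
    then show ?thesis using that unfolding qt_fib_rec_def by metis
  qed
  show ?thesis unfolding *[OF assms(1)] *[OF assms(2)] by (simp add: algebra_simps)
qed

text \<open>Each step from n to n + 1 multiplies the Casoratian by
  \<open>- t * q powi n\<close>, so the exponents of q add up to
  \<open>tri n\<close>.\<close>

lemma casorati_closed_form:
  assumes "t \<noteq> 0" "q \<noteq> 0" "qt_fib_rec t q F" "qt_fib_rec t q G"
  shows "F n * G (n + 1) - F (n + 1) * G n = (- t) powi n * q powi tri n * (F 0 * G 1 - F 1 * G 0)"
proof (induction n rule: int_induct[where k = 0])
  case (step1 i)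
  have "F (i + 1) * G (i + 1 + 1) - F (i + 1 + 1) * G (i + 1)
      = - t * q powi i * (F i * G (i + 1) - F (i + 1) * G i)"
    using casorati_step[OF assms(3,4), of i] by (simp add: add.assoc)
  then show ?case using step1 assms by (simp add: tri_Suc power_int_add)
next
  case (step2 i)
  define j where "j = i - 1"
  have i: "i = j + 1" by (simp add: j_def)
  have "- t * q powi j * (F j * G (j + 1) - F (j + 1) * G j) = F (j + 1) * G (j + 1 + 1) - F (j + 1 + 1) * G (j + 1)"
    using casorati_step[OF assms(3,4), of j] by (simp add: add.assoc)
  also have "\<dots> = - t * q powi j * ((- t) powi j * q powi tri j * (F 0 * G 1 - F 1 * G 0))"
    using step2 assms by (simp add: i tri_Suc power_int_add)
  finally show ?case using assms by (simp add: j_def)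
qed simp

lemma qt_fib_rec_mu_sum:
  fixes q x y :: complex assumes "q \<noteq> 0" "norm q < 1" "x \<notin> qint_powers q" "y \<noteq> 0"
  shows "qt_fib_rec (x * y) q (\<lambda>n. \<kappa> * mu_sum q (x * q powi (n - 1)) y)"
  unfolding qt_fib_rec_def
proof
  fix n
  define w where "w = x * q powi (n - 2)"
  have "mu_sum q (w * q) y = mu_sum q w y + w * y * mu_sum q (w / q) y"
    using assms by (intro mu_sum_recurrence) (auto simp: w_def qint_powers_mult_iff)
  moreover have "w * q = x * q powi (n - 1)" "w = x * q powi (n - 1 - 1)" "w / q = x * q powi (n - 2 - 1)"
    using assms(1) by (simp_all add: w_def power_int_diff field_simps power2_eq_square power3_eq_cube)
  ultimately have "mu_sum q (x * q powi (n - 1)) y = mu_sum q (x * q powi (n - 1 - 1)) y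
      + (x * q powi (n - 2)) * y * mu_sum q (x * q powi (n - 2 - 1)) y"
    by (metis w_def)
  then show "\<kappa> * mu_sum q (x * q powi (n - 1)) y = \<kappa> * mu_sum q (x * q powi (n - 1 - 1)) y
      + x * y * q powi (n - 2) * (\<kappa> * mu_sum q (x * q powi (n - 2 - 1)) y)"
    by (simp only:) (simp only: algebra_simps)
qed

text \<open>The power series \<open>\<^sub>0\<phi>\<^sub>1\<close> satisfies the q-difference
  equation \<open>phi01_recurrence\<close>; the prefactor converts it into the Fibonacci
  recurrence.\<close>

lemma qt_fib_rec_phi01:
  fixes q t :: complex assumes "q \<noteq> 0" "norm q < 1" "t \<noteq> 0"
  shows "qt_fib_rec t q (\<lambda>n. (- t) powi n * q powi tri n * phi01 q (t * q powi (n + 1)))"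
  unfolding qt_fib_rec_def
proof
  fix n :: int
  define m where "m = n - 2"
  have n: "n = m + 1 + 1" by (simp add: m_def)
  have m: "m + 1 + 1 - 1 = m + 1" "m + 1 + 1 - 2 = m" by simp_all
  define z where "z = t * q powi (m + 1)"
  have z: "t * q powi (m + 1 + 1) = q * z" "t * q powi (m + 1 + 1 + 1) = q ^ 2 * z"
    using assms(1) by (simp_all add: z_def power_int_add power2_eq_square power3_eq_cube)
  have double: "q powi (2 * m) = q powi m * q powi m"
    using power_int_add[of q m m] assms by simp
  have pw: "(- t) powi (m + 1) * q powi tri (m + 1) = (- t) powi m * q powi tri m * (- t * q powi m)"
    "(- t) powi (m + 1 + 1) * q powi tri (m + 1 + 1) = (- t) powi m * q powi tri m * (t * q powi m * z)"
    unfolding tri_Suc z_def using assms by (simp_all add: power_int_add power2_eq_square double)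
  have "z * phi01 q (q ^ 2 * z) = phi01 q z - phi01 q (q * z)"
    using phi01_recurrence[OF assms(1,2)] by simp
  then have "(- t) powi m * q powi tri m * (t * q powi m * z) * phi01 q (q ^ 2 * z)
    = (- t) powi m * q powi tri m * (t * q powi m) * (phi01 q z - phi01 q (q * z))"
    by (simp add: mult.assoc)
  then show "(- t) powi n * q powi tri n * phi01 q (t * q powi (n + 1))
      = (- t) powi (n - 1) * q powi tri (n - 1) * phi01 q (t * q powi (n - 1 + 1))
        + t * q powi (n - 2) * ((- t) powi (n - 2) * q powi tri (n - 2) * phi01 q (t * q powi (n - 2 + 1)))"
    unfolding n m z pw unfolding z_def[symmetric] by (simp add: algebra_simps)
qed

text \<open>After division by the geometric factor of \<open>casorati_closed_form\<close>, the
  Casoratian of the two solutions is constant in n. For n tending to infinity the values of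
  \<open>\<^sub>0\<phi>\<^sub>1\<close> tend to 1, the term with \<open>q\<^sup>n\<close> dies
  out, and what remains is the limit of \<open>mu_sum\<close>, the theta series evaluated by the
  Jacobi triple product.\<close>

lemma phi01_mu_sum_casorati:
  fixes q x y :: complex assumes "q \<noteq> 0" "norm q < 1" "x \<notin> qint_powers q" "x \<noteq> 0" "y \<noteq> 0"
  shows "phi01 q (x * y * q) * mu_sum q x y + x * y * phi01 q (x * y * q ^ 2) * mu_sum q (x / q) y
    = qpoch_inf q q * theta q (1 / y)"
proof -
  define t where "t = x * y"
  have t: "t \<noteq> 0" using assms by (simp add: t_def)
  define H where "H n = (- t) powi n * q powi tri n * phi01 q (t * q powi (n + 1))" for n
  define G where "G n = mu_sum q (x * q powi (n - 1)) y" for n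
  have H: "qt_fib_rec t q H" unfolding H_def using qt_fib_rec_phi01[OF assms(1,2) t] .
  have G: "qt_fib_rec t q G" unfolding G_def t_def using qt_fib_rec_mu_sum[OF assms(1-3,5), of 1] by simp
  define W where "W = H 0 * G 1 - H 1 * G 0"
  have W: "W = phi01 q (x * y * q) * mu_sum q x y + x * y * phi01 q (x * y * q ^ 2) * mu_sum q (x / q) y"
    by (simp add: W_def H_def G_def t_def power_int_minus divide_inverse)
  \<comment> \<open>The Casoratian of H and G at n is P times the left side, and P times W by the closed form.\<close>
  have const: "phi01 q (q ^ Suc n * t) * G (int (Suc n)) + t * q ^ n * phi01 q (q ^ Suc (Suc n) * t) * G (int n) = W" for n
  proof -
    define P where "P = (- t) powi int n * q powi tri (int n)"
    have P: "P \<noteq> 0" using t assms by (simp add: P_def)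
    have H0: "H (int n) = P * phi01 q (q ^ Suc n * t)"
      using assms(1) by (simp add: H_def P_def power_int_add mult_ac)
    have H1: "H (int n + 1) = P * (- t * q ^ n) * phi01 q (q ^ Suc (Suc n) * t)"
      using assms(1) t by (simp add: H_def P_def tri_Suc power_int_add power2_eq_square mult_ac)
    have "H (int n) * G (int n + 1) - H (int n + 1) * G (int n) = P * W"
      using casorati_closed_form[OF t assms(1) H G, of "int n"] by (simp add: P_def W_def)
    then have "P * (phi01 q (q ^ Suc n * t) * G (int (Suc n)) + t * q ^ n * phi01 q (q ^ Suc (Suc n) * t) * G (int n)) = P * W"
      unfolding H0 H1 by (simp add: algebra_simps)
    then show ?thesis using P by simp
  qed
  have phi: "(\<lambda>n. phi01 q (q ^ Suc n * t)) \<longlonglongrightarrow> 1"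
    by (rule LIMSEQ_Suc[OF phi01_limit[OF assms(1,2)]])
  have phi': "(\<lambda>n. phi01 q (q ^ Suc (Suc n) * t)) \<longlonglongrightarrow> 1"
    by (rule LIMSEQ_Suc[OF phi])
  have G1: "(\<lambda>n. G (int (Suc n))) \<longlonglongrightarrow> theta_series q (- 1 / y)"
    using mu_sum_limit[OF assms(1-3,5)] by (simp add: G_def)
  have G0: "(\<lambda>n. G (int n)) \<longlonglongrightarrow> theta_series q (- 1 / y)"
    by (rule LIMSEQ_imp_Suc[OF G1])
  have "(\<lambda>n. t * q ^ n) \<longlonglongrightarrow> t * 0"
    by (intro tendsto_mult tendsto_const LIMSEQ_power_zero assms)
  then have "(\<lambda>n. phi01 q (q ^ Suc n * t) * G (int (Suc n)) + t * q ^ n * phi01 q (q ^ Suc (Suc n) * t) * G (int n))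
      \<longlonglongrightarrow> 1 * theta_series q (- 1 / y) + t * 0 * 1 * theta_series q (- 1 / y)"
    by (rule tendsto_add[OF tendsto_mult[OF phi G1] tendsto_mult[OF tendsto_mult[OF _ phi'] G0]])
  then have "W = theta_series q (- 1 / y)" unfolding const by (simp add: LIMSEQ_const_iff)
  then show ?thesis unfolding W using jacobi_triple_product[OF assms(1,2), of "1 / y"] assms by simp
qed

section \<open>Theta functions of degree two\<close>

text \<open>A product of two theta series is a sum over a square lattice. Rotating the lattice by
  45 degrees, that is, passing to half the sum and half the difference of the indices, splits it
  by parity into two products of theta series for \<open>q\<^sup>2\<close>.\<close>

lemma theta_series_product:
  fixes q z w :: complex assumes "q \<noteq> 0" "norm q < 1" "z \<noteq> 0" "w \<noteq> 0"
  shows "theta_series q (- z) * theta_series q (- w) =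
    theta_series (q ^ 2) (z * w) * theta_series (q ^ 2) (q * (z / w))
    - w * (theta_series (q ^ 2) (z / w) * theta_series (q ^ 2) (q * (z * w)))"
proof -
  have q2: "q ^ 2 \<noteq> 0" "norm (q ^ 2) < 1"
    using assms by (auto simp: norm_power power_less_one_iff)
  define f where "f b v n = b powi tri n * v powi n" for b v :: complex and n
  have f_sum: "(\<lambda>n. norm (f b v n)) summable_on UNIV" "(f b v has_sum theta_series b v) UNIV"
    if "b \<noteq> 0" "norm b < 1" "v \<noteq> 0" for b v
    using theta_series_summable[OF that] theta_series_has_sum[OF that] by (simp_all add: f_def[abs_def])
  define F where "F = (\<lambda>(g, h). f q (- z) g * f q (- w) h)"
  have tri_pm: "tri (s + r) + tri (s - r) = 2 * tri s + (2 * tri r + r)" for s r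
  proof -
    have "2 * (tri (s + r) + tri (s - r)) = 2 * (2 * tri s + (2 * tri r + r))"
      by (simp only: distrib_left two_tri) (simp add: algebra_simps)
    then show ?thesis by simp
  qed
  have F: "F (g, h) = q powi (tri g + tri h) * ((- 1) powi (g + h) * (z powi g * w powi h))" for g h
  proof -
    have minus: "(- v) powi n = (- 1) powi n * v powi n" for v :: complex and n :: int
      using power_int_mult_distrib[of "- 1" v n] by (simp only: mult_minus1)
    show ?thesis using assms(1)
      by (simp add: F_def f_def minus[of z] minus[of w] power_int_add mult_ac)
  qed
  have e2: "(q ^ 2) powi k = q powi (2 * k)" for k using power_int_mult[of q 2 k] by simp
  have split_pow: "a powi (s + r) * b powi (s - r) = (a * b) powi s * (a / b) powi r"
    if "a \<noteq> 0" "b \<noteq> 0" for a b :: complex and s r :: int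
    using that by (simp add: power_int_add power_int_diff power_int_mult_distrib power_int_divide_distrib)
  have G: "f (q ^ 2) a s * f (q ^ 2) (q * b) r = q powi (2 * tri s + (2 * tri r + r)) * (a powi s * b powi r)" for a b s r
    using assms(1) by (simp add: f_def e2 power_int_add power_int_mult_distrib mult_ac)
  \<comment> \<open>Pairs of equal parity are \<open>(s + r, s - r)\<close>; since \<open>tri\<close> is invariant under \<open>h \<mapsto> 1 - h\<close>, the pairs
    \<open>(s + r, 1 - (s - r))\<close> of different parity give the same power of q.\<close>
  have "(F has_sum (theta_series (q ^ 2) (z * w) * theta_series (q ^ 2) (q * (z / w)))) {(g, h). even (g + h)}"
  proof (rule has_sum_reindex_bij_witness[THEN iffD1])
    show "((\<lambda>(s, r). f (q ^ 2) (z * w) s * f (q ^ 2) (q * (z / w)) r) has_sum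
        (theta_series (q ^ 2) (z * w) * theta_series (q ^ 2) (q * (z / w)))) (UNIV \<times> UNIV)"
      by (rule has_sum_product; rule f_sum) (use assms q2 in auto)
    fix a :: "int \<times> int"
    obtain s r where a: "a = (s, r)" by (cases a)
    show "(\<lambda>(g, h). ((g + h) div 2, (g - h) div 2)) ((\<lambda>(s, r). (s + r, s - r)) a) = a"
      and "(\<lambda>(s, r). (s + r, s - r)) a \<in> {(g, h). even (g + h)}" by (auto simp: a)
    have "even (s + r + (s - r))" by simp
    then have "(- 1) powi (s + r + (s - r)) = (1 :: complex)" by (simp only: power_int_minus_left_even power_int_1_left)
    then show "F ((\<lambda>(s, r). (s + r, s - r)) a) = (\<lambda>(s, r). f (q ^ 2) (z * w) s * f (q ^ 2) (q * (z / w)) r) a"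
      using split_pow[OF assms(3,4), of s r] tri_pm[of s r] by (simp only: a prod.case F G mult_1_left)
  next
    fix b :: "int \<times> int" assume "b \<in> {(g, h). even (g + h)}"
    then obtain g h where b: "b = (g, h)" "even (g + h)" by auto
    have "even (g - h)" using b(2) by simp
    then show "(\<lambda>(s, r). (s + r, s - r)) ((\<lambda>(g, h). ((g + h) div 2, (g - h) div 2)) b) = b"
      using b(2) unfolding b(1) prod.case prod.inject by presburger
  qed auto
  moreover have "(F has_sum (- w * (theta_series (q ^ 2) (z / w) * theta_series (q ^ 2) (q * (z * w))))) (- {(g, h). even (g + h)})"
  proof (rule has_sum_reindex_bij_witness[THEN iffD1])
    have "((\<lambda>(s, r). f (q ^ 2) (z / w) s * f (q ^ 2) (q * (z * w)) r) has_sum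
        (theta_series (q ^ 2) (z / w) * theta_series (q ^ 2) (q * (z * w)))) (UNIV \<times> UNIV)"
      by (rule has_sum_product; rule f_sum) (use assms q2 in auto)
    from has_sum_cmult_right[OF this, of "- w"]
    show "((\<lambda>(s, r). - w * (f (q ^ 2) (z / w) s * f (q ^ 2) (q * (z * w)) r)) has_sum
        (- w * (theta_series (q ^ 2) (z / w) * theta_series (q ^ 2) (q * (z * w))))) (UNIV \<times> UNIV)"
      by (simp add: case_prod_unfold)
    fix a :: "int \<times> int"
    obtain s r where a: "a = (s, r)" by (cases a)
    show "(\<lambda>(g, h). ((g + (1 - h)) div 2, (g - (1 - h)) div 2)) ((\<lambda>(s, r). (s + r, 1 - (s - r))) a) = a"
      and "(\<lambda>(s, r). (s + r, 1 - (s - r))) a \<in> - {(g, h). even (g + h)}" by (auto simp: a)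
    have "odd (s + r + (1 - (s - r)))" by simp
    then have "(- 1) powi (s + r + (1 - (s - r))) = (- 1 :: complex)" 
      by (simp only: power_int_minus_left_odd power_int_1_left simp_thms)
    moreover have "z powi (s + r) * w powi (1 - (s - r)) = w * ((z / w) powi s * (z * w) powi r)"
      using split_pow[of z "1 / w" s r] assms
      by (simp add: power_int_diff power_int_divide_distrib)
    ultimately show "F ((\<lambda>(s, r). (s + r, 1 - (s - r))) a)
        = (\<lambda>(s, r). - w * (f (q ^ 2) (z / w) s * f (q ^ 2) (q * (z * w)) r)) a"
      using tri_pm[of s r] by (simp only: a prod.case F G tri_reflect) simp
  next
    fix b :: "int \<times> int" assume "b \<in> - {(g, h). even (g + h)}"
    then obtain g h where b: "b = (g, h)" "odd (g + h)" by auto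
    have "even (g + (1 - h))" "even (g - (1 - h))" using b(2) by presburger+
    then show "(\<lambda>(s, r). (s + r, 1 - (s - r))) ((\<lambda>(g, h). ((g + (1 - h)) div 2, (g - (1 - h)) div 2)) b) = b"
      unfolding b(1) prod.case prod.inject by presburger
  qed auto
  ultimately have "(F has_sum (theta_series (q ^ 2) (z * w) * theta_series (q ^ 2) (q * (z / w))
      + - w * (theta_series (q ^ 2) (z / w) * theta_series (q ^ 2) (q * (z * w)))))
      ({(g, h). even (g + h)} \<union> - {(g, h). even (g + h)})"
    by (rule has_sum_Un_disjoint) auto
  moreover have "(F has_sum (theta_series q (- z) * theta_series q (- w))) (UNIV \<times> UNIV)"
    unfolding F_def by (rule has_sum_product; rule f_sum) (use assms in auto)
  ultimately show ?thesis
    using has_sum_unique by (force simp: Compl_partition)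
qed

lemma has_sum_even_odd_split:
  fixes c :: "nat \<Rightarrow> complex"
  assumes "(c has_sum S) UNIV"
  obtains e d where "((\<lambda>r. c (2 * r)) has_sum e) UNIV" "((\<lambda>r. c (Suc (2 * r))) has_sum d) UNIV" "S = e + d"
proof -
  have sub: "c summable_on B" for B
    using assms by (meson has_sum_imp_summable subset_UNIV summable_on_subset_banach)
  define e where "e = infsum c (range (\<lambda>r. 2 * r))"
  define d where "d = infsum c (range (\<lambda>r. Suc (2 * r)))"
  have e: "(c has_sum e) (range (\<lambda>r. 2 * r))" and d: "(c has_sum d) (range (\<lambda>r. Suc (2 * r)))"
    unfolding e_def d_def by (rule has_sum_infsum[OF sub])+
  have disj: "range (\<lambda>r. 2 * r) \<inter> range (\<lambda>r. Suc (2 * r)) = {}" by auto presburger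
  have un: "range (\<lambda>r. 2 * r) \<union> range (\<lambda>r. Suc (2 * r)) = UNIV"
    by (auto elim: oddE evenE) (metis evenE oddE Suc_eq_plus1 rangeI)
  have "S = e + d"
    using has_sum_Un_disjoint[OF e d disj] assms has_sum_unique unfolding un by blast
  moreover have "((\<lambda>r. c (2 * r)) has_sum e) UNIV"
    using e by (subst (asm) has_sum_reindex) (auto simp: inj_on_def o_def)
  moreover have "((\<lambda>r. c (Suc (2 * r))) has_sum d) UNIV"
    using d by (subst (asm) has_sum_reindex) (auto simp: inj_on_def o_def)
  ultimately show ?thesis using that by blast
qed

text \<open>Multiplication by \<open>theta q x\<close> cancels the denominators
  \<open>(x q\<^sup>k)\<^sub>\<infinity>\<close> of \<open>mu_sum q x (t / x)\<close> (see
  \<open>cleared_mu_series_eq_mu_sum\<close>). The resulting series has no poles; in particular it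
  can be evaluated at x = 1.\<close>

definition cleared_mu_series :: "complex \<Rightarrow> complex \<Rightarrow> complex \<Rightarrow> complex" where
  "cleared_mu_series q t x = (\<Sum>\<^sub>\<infinity>k::int. q powi (2 * tri k) * (x ^ 2 / t) powi k * qpoch_inf q (q powi (1 - k) / x))"

text \<open>As functions of x with t fixed, these series lie in the two-dimensional space of theta
  functions of degree 2 for q. The two basis functions are the even and the odd theta series in x,
  and the coefficients \<open>\<alpha>\<close> and \<open>\<beta>\<close> depend on q and t
  only.\<close>

lemma cleared_mu_series_theta_space:
  fixes q t :: complex assumes "q \<noteq> 0" "norm q < 1" "t \<noteq> 0"
  obtains \<alpha> \<beta> where "\<And>x. x \<noteq> 0 \<Longrightarrow>
    ((\<lambda>k::int. q powi (2 * tri k) * (x ^ 2 / t) powi k * qpoch_inf q (q powi (1 - k) / x)) has_sum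
       (theta_series (q ^ 2) (x ^ 2 / t) * \<alpha> + x * theta_series (q ^ 2) (q * (x ^ 2 / t)) * \<beta>)) UNIV"
proof -
  have q2: "q ^ 2 \<noteq> 0" "norm (q ^ 2) < 1"
    using assms by (auto simp: norm_power power_less_one_iff)
  have e2: "(q ^ 2) powi k = q powi (2 * k)" for k using power_int_mult[of q 2 k] by simp
  \<comment> \<open>The even and the odd part of Euler's expansion give two sums over j, whose dependence on x
    separates after the shift of k by r, respectively r + 1.\<close>
  define v0 where "v0 r = (q ^ 2) powi tri (int r) * (q / t) ^ r / qfac q (2 * r)" for r :: nat
  define v1 where "v1 r = - (1 / t) * ((q ^ 2) powi tri (int r) * (q ^ 2 / t) ^ r / qfac q (Suc (2 * r)))" for r :: nat
  have s0: "summable (\<lambda>r. norm (v0 r))"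
    unfolding v0_def by (rule summable_div_qfac[OF assms(2) theta_series_norm_summable_nat[OF q2]])
  have s1: "summable (\<lambda>r. norm (v1 r))"
    unfolding v1_def norm_mult[of "- (1 / t)"]
    by (rule summable_mult[OF summable_div_qfac[OF assms(2) theta_series_norm_summable_nat[OF q2]]])
  show ?thesis
  proof (rule that)
    fix x :: complex assume x: "x \<noteq> 0"
    define W where "W k = q powi (2 * tri k) * (x ^ 2 / t) powi k" for k :: int
    define c where "c k j = q powi tri (int j) / qfac q j * (- (q powi (1 - k) / x)) ^ j" for k :: int and j :: nat
    have c: "(c k has_sum qpoch_inf q (q powi (1 - k) / x)) UNIV" for k
      unfolding c_def by (rule euler_expansion_has_sum[OF assms(1,2)])
    have "\<forall>k. \<exists>e d. ((\<lambda>r. c k (2 * r)) has_sum e) UNIV \<and> ((\<lambda>r. c k (Suc (2 * r))) has_sum d) UNIV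
        \<and> qpoch_inf q (q powi (1 - k) / x) = e + d"
      using has_sum_even_odd_split[OF c] by metis
    then obtain e d where e: "\<And>k. ((\<lambda>r. c k (2 * r)) has_sum e k) UNIV"
      and d: "\<And>k. ((\<lambda>r. c k (Suc (2 * r))) has_sum d k) UNIV"
      and ed: "\<And>k. qpoch_inf q (q powi (1 - k) / x) = e k + d k" by metis
    define u0 where "u0 s = (q ^ 2) powi tri s * (x ^ 2 / t) powi s" for s
    define u1 where "u1 s = x * ((q ^ 2) powi tri s * (q * (x ^ 2 / t)) powi s)" for s
    have "((\<lambda>k. W k * e k) has_sum (theta_series (q ^ 2) (x ^ 2 / t) * suminf v0)) UNIV"
    proof (rule has_sum_shifted_product)
      show "(\<lambda>n. norm (u0 n)) summable_on UNIV" "(u0 has_sum theta_series (q ^ 2) (x ^ 2 / t)) UNIV"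
        unfolding u0_def by (rule theta_series_summable theta_series_has_sum; use q2 x assms in simp)+
      show "summable (\<lambda>r. norm (v0 r))" by (rule s0)
      then show "v0 sums suminf v0" by (rule summable_sums[OF summable_norm_cancel])
      fix k
      have "u0 (k + (- int r)) * v0 r = W k * c k (2 * r)" for r
      proof -
        have ex: "2 * tri (k - int r) + 2 * tri (int r) + int r
            = 2 * tri k + (tri (2 * int r) + (1 - k) * (2 * int r))"
        proof -
          have "tri (2 * int r) = int r * (2 * int r - 1)" by (rule tri_eqI) simp
          then show ?thesis by (simp only: two_tri) (simp add: algebra_simps)
        qed
        have a1: "(x ^ 2 / t) powi (k - int r) * (q / t) ^ r
            = (x ^ 2 / t) powi k * (q powi int r * (1 / x ^ 2) ^ r)"
          using x assms by (simp add: power_int_diff power_divide)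
        have a2: "(- (q powi (1 - k) / x)) ^ (2 * r) = q powi ((1 - k) * (2 * int r)) * (1 / x ^ 2) ^ r"
        proof -
          have "q powi ((1 - k) * (2 * int r)) = (q powi (1 - k)) ^ (2 * r)"
            using power_int_mult[of q "1 - k" "int (2 * r)"] by (simp only: power_int_of_nat) simp
          then show ?thesis by (simp add: power_divide power_mult)
        qed
        have "u0 (k + (- int r)) * v0 r
            = q powi (2 * tri (k - int r)) * q powi (2 * tri (int r))
              * ((x ^ 2 / t) powi (k - int r) * (q / t) ^ r) / qfac q (2 * r)"
          by (simp add: u0_def v0_def e2)
        also have "\<dots> = q powi (2 * tri (k - int r) + 2 * tri (int r) + int r)
            * (x ^ 2 / t) powi k * (1 / x ^ 2) ^ r / qfac q (2 * r)"
          unfolding a1 using assms(1) by (simp add: power_int_add)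
        also have "\<dots> = W k * c k (2 * r)"
          unfolding ex W_def c_def a2 using assms(1) by (simp add: power_int_add)
        finally show ?thesis .
      qed
      then show "((\<lambda>r. u0 (k + (- int r)) * v0 r) has_sum W k * e k) UNIV"
        using has_sum_cmult_right[OF e[of k], of "W k"] by simp
    qed
    moreover have "((\<lambda>k. W k * d k) has_sum ((x * theta_series (q ^ 2) (q * (x ^ 2 / t))) * suminf v1)) UNIV"
    proof (rule has_sum_shifted_product)
      show "(\<lambda>n. norm (u1 n)) summable_on UNIV"
        unfolding u1_def norm_mult[of x]
        by (intro summable_on_cmult_right theta_series_summable; use q2 x assms in simp)
      show "(u1 has_sum (x * theta_series (q ^ 2) (q * (x ^ 2 / t)))) UNIV"
        unfolding u1_def by (intro has_sum_cmult_right theta_series_has_sum; use q2 x assms in simp)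
      show "summable (\<lambda>r. norm (v1 r))" by (rule s1)
      then show "v1 sums suminf v1" by (rule summable_sums[OF summable_norm_cancel])
      fix k
      have "u1 (k + (- int r - 1)) * v1 r = W k * c k (Suc (2 * r))" for r
      proof -
        have ex: "2 * tri (k + (- int r - 1)) + 2 * tri (int r) + (k + (- int r - 1)) + 2 * int r
            = 2 * tri k + (tri (2 * int r + 1) + (1 - k) * (2 * int r + 1))"
        proof -
          have "tri (2 * int r + 1) = int r * (2 * int r + 1)" by (rule tri_eqI) (simp add: algebra_simps)
          then show ?thesis by (simp only: two_tri) (simp add: algebra_simps)
        qed
        have a1: "(x ^ 2 / t) powi (k + (- int r - 1)) * (1 / t) ^ r * (x * (1 / t))
            = (x ^ 2 / t) powi k * ((1 / x ^ 2) ^ r * (1 / x))"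
          using x assms by (simp add: power_int_diff power_int_minus power_divide power2_eq_square power_int_add power_mult_distrib)
        have a2: "(- (q powi (1 - k) / x)) ^ Suc (2 * r)
            = - (q powi ((1 - k) * (2 * int r + 1))) * ((1 / x ^ 2) ^ r * (1 / x))"
        proof -
          have "q powi ((1 - k) * (2 * int r + 1)) = (q powi (1 - k)) powi (2 * int r + 1)"
            by (rule power_int_mult)
          also have "\<dots> = (q powi (1 - k)) ^ Suc (2 * r)"
            using power_int_of_nat[of "q powi (1 - k)" "Suc (2 * r)"] by (simp add: add.commute)
          finally show ?thesis by (simp add: power_divide power_mult)
        qed
        have "u1 (k + (- int r - 1)) * v1 r
            = - (q powi (2 * tri (k + (- int r - 1))) * q powi (2 * tri (int r)) * q powi (k + (- int r - 1))
              * q powi (2 * int r))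
              * ((x ^ 2 / t) powi (k + (- int r - 1)) * (1 / t) ^ r * (x * (1 / t))) / qfac q (Suc (2 * r))"
        proof -
          have "(q ^ 2 / t) ^ r = q powi (2 * int r) * (1 / t) ^ r"
            using power_int_mult[of q 2 "int r"] by (simp add: power_divide)
          then show ?thesis
            unfolding u1_def v1_def e2 power_int_mult_distrib[of q "x ^ 2 / t"] by (simp only:) simp
        qed
        also have "\<dots> = - (q powi (2 * tri (k + (- int r - 1)) + 2 * tri (int r) + (k + (- int r - 1)) + 2 * int r))
            * (x ^ 2 / t) powi k * ((1 / x ^ 2) ^ r * (1 / x)) / qfac q (Suc (2 * r))"
          unfolding a1 power_int_add[OF disjI1[OF assms(1)]] by (simp only: mult_ac mult_minus_left)
        also have "\<dots> = W k * c k (Suc (2 * r))"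
        proof -
          have suc: "int (Suc (2 * r)) = 2 * int r + 1" by simp
          show ?thesis
            unfolding ex W_def c_def a2 suc power_int_add[OF disjI1[OF assms(1)]] by (simp add: mult_ac)
        qed
        finally show ?thesis .
      qed
      then show "((\<lambda>r. u1 (k + (- int r - 1)) * v1 r) has_sum W k * d k) UNIV"
        using has_sum_cmult_right[OF d[of k], of "W k"] by simp
    qed
    ultimately have "((\<lambda>k. W k * e k + W k * d k) has_sum (theta_series (q ^ 2) (x ^ 2 / t) * suminf v0
        + x * theta_series (q ^ 2) (q * (x ^ 2 / t)) * suminf v1)) UNIV"
      by (rule has_sum_add)
    then show "((\<lambda>k::int. q powi (2 * tri k) * (x ^ 2 / t) powi k * qpoch_inf q (q powi (1 - k) / x)) has_sum
       (theta_series (q ^ 2) (x ^ 2 / t) * suminf v0 + x * theta_series (q ^ 2) (q * (x ^ 2 / t)) * suminf v1)) UNIV"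
      unfolding ed W_def[symmetric] by (simp add: distrib_left)
  qed
qed

text \<open>A three-term relation of Weierstrass type. By \<open>theta_series_product\<close> and
  the Jacobi triple product, the antisymmetric form of the basis functions A and
  \<open>x * B x\<close> at x and w is a multiple of
  \<open>theta q (x * w / t) * theta q (x / w)\<close>; with w = 1 this also puts
  \<open>theta q x * theta q (x / t)\<close> into the space.\<close>

lemma cleared_mu_series_three_term:
  fixes q t x w :: complex assumes "q \<noteq> 0" "norm q < 1" "t \<noteq> 0" "x \<noteq> 0" "w \<noteq> 0"
  shows "cleared_mu_series q t x * (theta q (w / t) * theta q w) - cleared_mu_series q t w * (theta q (x / t) * theta q x)
    = - w * cleared_mu_series q t 1 * (theta q (x * w / t) * theta q (x / w))"
proof -
  define A where "A x = theta_series (q ^ 2) (x ^ 2 / t)" for x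
  define B where "B x = theta_series (q ^ 2) (q * (x ^ 2 / t))" for x
  obtain \<alpha> \<beta> where Q': "\<And>x. x \<noteq> 0 \<Longrightarrow>
    ((\<lambda>k::int. q powi (2 * tri k) * (x ^ 2 / t) powi k * qpoch_inf q (q powi (1 - k) / x)) has_sum
       (A x * \<alpha> + x * B x * \<beta>)) UNIV"
    using cleared_mu_series_theta_space[OF assms(1-3)] unfolding A_def B_def by blast
  have Q: "cleared_mu_series q t x = A x * \<alpha> + x * B x * \<beta>" if "x \<noteq> 0" for x
    unfolding cleared_mu_series_def using Q'[OF that] by (rule infsumI)
  \<comment> \<open>The antisymmetric form of A and \<open>x * B x\<close> at two points is a product of two theta values.\<close>
  have J: "z * (qpoch_inf q q ^ 2 * (theta q (v * z / t) * theta q (v / z))) = z * A v * B z - v * A z * B v"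
    if "v \<noteq> 0" "z \<noteq> 0" for v z
  proof -
    have "v * z / t * (v / z) = v ^ 2 / t" "v * z / t / (v / z) = z ^ 2 / t"
      using that by (simp_all add: power2_eq_square)
    moreover have "theta_series q (- (v * z / t)) * theta_series q (- (v / z)) =
      theta_series (q ^ 2) (v * z / t * (v / z)) * theta_series (q ^ 2) (q * (v * z / t / (v / z)))
      - v / z * (theta_series (q ^ 2) (v * z / t / (v / z)) * theta_series (q ^ 2) (q * (v * z / t * (v / z))))"
      by (rule theta_series_product) (use that assms in auto)
    ultimately have "theta_series q (- (v * z / t)) * theta_series q (- (v / z)) = A v * B z - v / z * (A z * B v)"
      by (simp only: A_def B_def)
    moreover have "theta_series q (- (v * z / t)) = qpoch_inf q q * theta q (v * z / t)"
      "theta_series q (- (v / z)) = qpoch_inf q q * theta q (v / z)"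
      by (rule jacobi_triple_product; use that assms in simp)+
    ultimately show ?thesis using that by (simp add: field_simps power2_eq_square)
  qed
  define p where "p = qpoch_inf q q ^ 2"
  have p: "p \<noteq> 0" using qpoch_qq_nonzero[OF assms(2)] by (simp add: p_def)
  have Jx: "p * (theta q (x / t) * theta q x) = A x * B 1 - x * A 1 * B x"
    using J[of x 1] assms by (simp add: p_def)
  have Jw: "p * (theta q (w / t) * theta q w) = A w * B 1 - w * A 1 * B w"
    using J[of w 1] assms by (simp add: p_def)
  have Jxw: "w * (p * (theta q (x * w / t) * theta q (x / w))) = w * A x * B w - x * A w * B x"
    using J[of x w] assms by (simp add: p_def)
  have "p * (cleared_mu_series q t x * (theta q (w / t) * theta q w) - cleared_mu_series q t w * (theta q (x / t) * theta q x))
    = cleared_mu_series q t x * (p * (theta q (w / t) * theta q w)) - cleared_mu_series q t w * (p * (theta q (x / t) * theta q x))"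
    by (simp add: algebra_simps)
  \<comment> \<open>Linear algebra in the two-dimensional space spanned by A and \<open>x * B x\<close>: every term is an
    antisymmetric form in the values at x, w and 1.\<close>
  also have "\<dots> = - cleared_mu_series q t 1 * (w * A x * B w - x * A w * B x)"
    unfolding Jx Jw using assms by (simp add: Q algebra_simps)
  also have "\<dots> = p * (- w * cleared_mu_series q t 1 * (theta q (x * w / t) * theta q (x / w)))"
    unfolding Jxw[symmetric] by (simp add: algebra_simps)
  finally show ?thesis using p by (simp only: mult_cancel_left) simp
qed

text \<open>The factor \<open>(q\<^sup>1\<^sup>-\<^sup>k)\<^sub>\<infinity>\<close> makes the
  terms of positive index vanish, and the remaining ones are those of
  \<open>\<^sub>0\<phi>\<^sub>1\<close>.\<close>

lemma cleared_mu_series_1: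
  fixes q t :: complex assumes "q \<noteq> 0" "norm q < 1" "t \<noteq> 0"
  shows "cleared_mu_series q t 1 = qpoch_inf q q * phi01 q (t * q ^ 2)"
proof -
  define g where "g k = q powi (2 * tri k) * (1 / t) powi k * qpoch_inf q (q powi (1 - k))" for k :: int
  have gm: "g (- int m) = qpoch_inf q q * (q powi (2 * tri (int m)) / qfac q m * (t * q ^ 2) ^ m)" for m
  proof -
    have "q powi (1 - - int m) = q ^ Suc m" using assms(1) by (simp add: power_int_add)
    moreover have "q powi (2 * tri (- int m)) = q powi (2 * tri (int m)) * (q ^ 2) ^ m"
      using assms(1) by (simp add: tri_minus power_int_add power_int_mult)
    moreover have "(1 / t) powi (- int m) = t ^ m" by (simp add: power_int_minus power_one_over)
    ultimately show ?thesis
      using qpoch_inf_qfac[OF assms(2), of m] qfac_nonzero[OF assms(2), of m]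
      by (simp add: g_def power_mult_distrib)
  qed
  have g0: "g k = 0" if "k > 0" for k
  proof -
    define m where "m = nat (k - 1)"
    have "1 - k = - int m" using that by (simp add: m_def)
    then have "q powi (1 - k) * q ^ m = 1" using assms(1) by (simp add: power_int_minus)
    then show ?thesis using qpoch_inf_eq_0[OF assms(2)] by (simp add: g_def)
  qed
  have "((\<lambda>m. q powi (2 * tri (int m)) / qfac q m * (t * q ^ 2) ^ m) has_sum phi01 q (t * q ^ 2)) UNIV"
    by (intro norm_summable_imp_has_sum phi01_term_summable phi01_sums assms)
  then have "((\<lambda>m. g (- int m)) has_sum (qpoch_inf q q * phi01 q (t * q ^ 2))) UNIV"
    unfolding gm by (rule has_sum_cmult_right)
  then have "(g has_sum (qpoch_inf q q * phi01 q (t * q ^ 2))) (range (\<lambda>m. - int m))"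
    by (subst has_sum_reindex) (auto simp: o_def inj_on_def)
  then have "(g has_sum (qpoch_inf q q * phi01 q (t * q ^ 2))) UNIV"
  proof (rule has_sum_cong_neutral[THEN iffD1, rotated -1])
    fix k :: int assume "k \<in> UNIV - range (\<lambda>m. - int m)"
    then have "k > 0" by (metis DiffE nonpos_int_cases not_less rangeI)
    then show "g k = 0" by (rule g0)
  qed auto
  then show ?thesis unfolding cleared_mu_series_def g_def by (simp add: infsumI)
qed

text \<open>Quasi-periodicity gives \<open>theta q x\<close> the factor
  \<open>(x q\<^sup>k)\<^sub>\<infinity> (q\<^sup>1\<^sup>-\<^sup>k / x)\<^sub>\<infinity>\<close>
  for every k, of which the first cancels.\<close>

lemma cleared_mu_series_eq_mu_sum:
  fixes q x y :: complex assumes "q \<noteq> 0" "norm q < 1" "x \<notin> qint_powers q" "x \<noteq> 0" "y \<noteq> 0"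
  shows "cleared_mu_series q (x * y) x = theta q x * mu_sum q x y"
proof -
  have "theta q x * (q powi tri k * (- 1 / y) powi k / qpoch_inf q (x * q powi k))
      = q powi (2 * tri k) * (x ^ 2 / (x * y)) powi k * qpoch_inf q (q powi (1 - k) / x)" for k
  proof -
    have nz: "qpoch_inf q (x * q powi k) \<noteq> 0"
      using qpoch_inf_nonzero_generic[OF assms(1,2), of "x * q powi k"]
        qint_powers_mult_iff[OF assms(1), of x k] assms(1,3) by simp
    have "q / (x * q powi k) = q powi (1 - k) / x" using assms(1) by (simp add: power_int_diff)
    then have "theta q x = q powi tri k * (- x) powi k * (qpoch_inf q (x * q powi k) * qpoch_inf q (q powi (1 - k) / x))"
      using theta_powi_shift[OF assms(1,2,4), of k] by (simp only: theta_def)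
    then have "theta q x * (q powi tri k * (- 1 / y) powi k / qpoch_inf q (x * q powi k))
      = (q powi tri k * q powi tri k) * ((- x) powi k * (- 1 / y) powi k) * qpoch_inf q (q powi (1 - k) / x)"
      using nz by simp
    also have "q powi tri k * q powi tri k = q powi (2 * tri k)"
      using power_int_add[of q "tri k" "tri k"] assms(1) by simp
    also have "(- x) powi k * (- 1 / y) powi k = (x ^ 2 / (x * y)) powi k"
      using assms by (simp flip: power_int_mult_distrib add: power2_eq_square)
    finally show ?thesis .
  qed
  then show ?thesis unfolding cleared_mu_series_def mu_sum_def
    by (simp flip: infsum_cmult_right')
qed

section \<open>The little \<open>\<mu>\<close>-function\<close>

lemma qpow_add: "qpow \<tau> (a + b) = qpow \<tau> a * qpow \<tau> b"
  by (simp add: qpow_def distrib_left exp_add)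

lemma qpow_of_int: "qpow \<tau> (of_int k) = nome \<tau> powi k"
  by (simp add: qpow_def exp_power_int mult_ac)

lemma qpow_nonzero: "qpow \<tau> s \<noteq> 0"
  by (simp add: qpow_def)

lemma norm_nome_less_1: "Im \<tau> > 0 \<Longrightarrow> norm (nome \<tau>) < 1"
  by (simp add: qpow_def)

text \<open>The theta quotient in the Casoratian of two little \<open>\<mu>\<close>-functions. It
  measures how far the little \<open>\<mu>\<close>-function is from depending on the product of
  its arguments only (see \<open>little_mu_diff\<close>).\<close>

definition theta_quot :: "complex \<Rightarrow> complex \<Rightarrow> complex \<Rightarrow> complex \<Rightarrow> complex" where
  "theta_quot q x y c = theta q c * theta q (y * c / x)
     / (theta q (c / x) * theta q (y * c) * theta q x * theta q y)"

text \<open>The factor by which \<open>little_mu_diff\<close> changes between x and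
  \<open>x / q\<close>. It makes the differences at two consecutive places the same multiple of
  the \<open>\<^sub>0\<phi>\<^sub>1\<close>-solution.\<close>

lemma theta_quot_div_q:
  fixes q x y c :: complex
  assumes "q \<noteq> 0" "norm q < 1" "x \<noteq> 0" "y \<noteq> 0" "c \<noteq> 0"
  shows "x * y * theta_quot q (x / q) y c = - q * theta_quot q x y c"
proof -
  have 1: "theta q (y * c / (x / q)) = - theta q (y * c / x) / (y * c / x)"
    using theta_mult_q[OF assms(1,2), of "y * c / x"] assms by (simp add: field_simps)
  have 2: "theta q (c / (x / q)) = - theta q (c / x) / (c / x)"
    using theta_mult_q[OF assms(1,2), of "c / x"] assms by (simp add: field_simps)
  have "theta q x = - theta q (x / q) / (x / q)"
    using theta_mult_q[OF assms(1,2), of "x / q"] assms by simp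
  then have 3: "theta q (x / q) = - (x / q) * theta q x"
    using assms by (simp add: field_simps)
  show ?thesis
    unfolding theta_quot_def 1 2 3 using assms by (simp add: field_simps)
qed

text \<open>The arguments of both functions have the product \<open>t = x y\<close>, so this is
  the three-term relation at \<open>x / c\<close> and x, divided by the theta values; the
  \<open>\<^sub>0\<phi>\<^sub>1\<close> is the value of the cleared series at 1.\<close>

lemma little_mu_diff:
  fixes q x y c \<tau> :: complex
  assumes q: "q = nome \<tau>" "q \<noteq> 0" "norm q < 1"
    and nz: "x \<noteq> 0" "y \<noteq> 0" "c \<noteq> 0"
    and generic: "x \<notin> qint_powers q" "y \<notin> qint_powers q" "x / c \<notin> qint_powers q" "y * c \<notin> qint_powers q"
  shows "little_mu \<tau> (x / c) (y * c) - little_mu \<tau> x y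
     = \<i> * qpow \<tau> (- 1 / 8) * (x * y) * phi01 q (x * y * q ^ 2) * theta_quot q x y c"
proof -
  define \<omega> where "\<omega> = \<i> * qpow \<tau> (- 1 / 8)"
  define p where "p = qpoch_inf q q"
  have p: "p \<noteq> 0" using qpoch_qq_nonzero[OF q(3)] by (simp add: p_def)
  have th: "theta q x \<noteq> 0" "theta q y \<noteq> 0" "theta q (x / c) \<noteq> 0" "theta q (y * c) \<noteq> 0"
    using generic by (auto dest: theta_nonzero[OF q(2,3)])
  define ph where "ph = phi01 q (x * y * q ^ 2)"
  define M where "M = mu_sum q x y"
  define M' where "M' = mu_sum q (x / c) (y * c)"
  have L: "little_mu \<tau> x y = \<omega> / (p * theta q (q * y)) * M"
    unfolding \<omega>_def p_def M_def by (rule little_mu_eq_mu_sum[OF q generic(1)])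
  have L': "little_mu \<tau> (x / c) (y * c) = \<omega> / (p * theta q (q * (y * c))) * M'"
    unfolding \<omega>_def p_def M'_def by (rule little_mu_eq_mu_sum[OF q generic(3)])
  have ty: "theta q (q * y) = - theta q y / y" "theta q (q * (y * c)) = - theta q (y * c) / (y * c)"
    by (rule theta_mult_q[OF q(2,3)]; use nz in simp)+
  have t1y: "theta q (1 / y) = - theta q y / y" "theta q (1 / (y * c)) = - theta q (y * c) / (y * c)"
    "theta q (1 / c) = - theta q c / c" "theta q (1 / (y * c / x)) = - theta q (y * c / x) / (y * c / x)"
    "theta q (1 / (c / x)) = - theta q (c / x) / (c / x)"
    by (rule theta_inverse[OF q(2,3)]; use nz in simp)+
  have Q: "cleared_mu_series q (x * y) x = theta q x * M"
    unfolding M_def by (rule cleared_mu_series_eq_mu_sum[OF q(2,3) generic(1) nz(1,2)])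
  have Q': "cleared_mu_series q (x * y) (x / c) = theta q (x / c) * M'"
    using cleared_mu_series_eq_mu_sum[OF q(2,3) generic(3), of "y * c"] nz by (simp add: M'_def)
  have "cleared_mu_series q (x * y) (x / c) * (theta q (x / (x * y)) * theta q x)
        - cleared_mu_series q (x * y) x * (theta q (x / c / (x * y)) * theta q (x / c))
      = - x * cleared_mu_series q (x * y) 1 * (theta q (x / c * x / (x * y)) * theta q (x / c / x))"
    by (rule cleared_mu_series_three_term[OF q(2,3)]) (use nz in auto)
  moreover have "x / (x * y) = 1 / y" "x / c / (x * y) = 1 / (y * c)"
     "x / c * x / (x * y) = 1 / (y * c / x)" "x / c / x = 1 / c"
    using nz by (simp_all add: field_simps)
  ultimately have eq: "theta q (x / c) * M' * ((- theta q y / y) * theta q x)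
      - theta q x * M * ((- theta q (y * c) / (y * c)) * theta q (x / c))
      = - x * (p * ph) * ((- theta q (y * c / x) / (y * c / x)) * (- theta q c / c))"
    using nz by (simp only: Q Q' t1y cleared_mu_series_1[OF q(2,3)] p_def ph_def mult_eq_0_iff simp_thms)
  have "theta q (x / c) * theta q x * (theta q (y * c) * M - c * theta q y * M')
      = (theta q (x / c) * M' * ((- theta q y / y) * theta q x)
      - theta q x * M * ((- theta q (y * c) / (y * c)) * theta q (x / c))) * (y * c)"
    using nz by (simp add: algebra_simps)
  also have "\<dots> = - (x ^ 2) * p * ph * theta q (y * c / x) * theta q c / c"
    unfolding eq using nz by (simp add: power2_eq_square)
  finally have "theta q (x / c) * theta q x * (theta q (y * c) * M - c * theta q y * M')
      = - (x ^ 2) * p * ph * theta q (y * c / x) * theta q c / c" .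
  note scaled = this
  have tcx': "theta q (x / c) = - (x / c) * theta q (c / x)"
    using t1y(5) nz by simp
  have tcx: "theta q (c / x) \<noteq> 0" using tcx' th(3) by auto
  have "x * (theta q (c / x) * theta q x * (theta q (y * c) * M - c * theta q y * M'))
      = x * (x * p * ph * theta q (y * c / x) * theta q c)"
    using scaled nz unfolding tcx' by (simp add: power2_eq_square field_simps)
  then have "theta q (c / x) * theta q x * (theta q (y * c) * M - c * theta q y * M')
      = x * p * ph * theta q (y * c / x) * theta q c"
    using nz(1) by (simp only: mult_cancel_left simp_thms)
  then have key: "theta q (y * c) * M - c * theta q y * M'
      = x * p * ph * theta q (y * c / x) * theta q c / (theta q (c / x) * theta q x)"
    using th(1) tcx by (metis divisors_zero nonzero_mult_div_cancel_left)
  have "little_mu \<tau> (x / c) (y * c) - little_mu \<tau> x y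
      = \<omega> * y / (p * theta q y * theta q (y * c)) * (theta q (y * c) * M - c * theta q y * M')"
    unfolding L L' ty using nz th p by (simp add: field_simps)
  also have "\<dots> = \<omega> * (x * y) * ph * theta_quot q x y c"
    unfolding key theta_quot_def using p by (simp add: mult_ac)
  finally show ?thesis unfolding \<omega>_def ph_def .
qed

lemma phi01_little_mu_casorati:
  fixes q x y \<tau> :: complex
  assumes q: "q = nome \<tau>" "q \<noteq> 0" "norm q < 1"
    and nz: "x \<noteq> 0" "y \<noteq> 0" and generic: "x \<notin> qint_powers q" "y \<notin> qint_powers q"
  shows "phi01 q (x * y * q) * little_mu \<tau> x y
      + x * y * phi01 q (x * y * q ^ 2) * little_mu \<tau> (x / q) y = \<i> * qpow \<tau> (- 1 / 8)"
proof -
  have xq: "x / q \<notin> qint_powers q"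
    using qint_powers_mult_iff[OF q(2), of x "-1"] generic(1) by (simp add: power_int_minus divide_inverse)
  define \<kappa> where "\<kappa> = \<i> * qpow \<tau> (- 1 / 8) / (qpoch_inf q q * theta q (q * y))"
  have "theta q (q * y) = theta q (1 / y)" using q(2) nz by (simp add: theta_def mult.commute)
  moreover have "theta q (1 / y) \<noteq> 0"
    using theta_nonzero[OF q(2,3), of "1 / y"] generic(2) qint_powers_inverse_iff[OF q(2)] by blast
  ultimately have "\<kappa> * (qpoch_inf q q * theta q (1 / y)) = \<i> * qpow \<tau> (- 1 / 8)"
    using qpoch_qq_nonzero[OF q(3)] by (simp add: \<kappa>_def)
  then show ?thesis
    unfolding little_mu_eq_mu_sum[OF q generic(1)] little_mu_eq_mu_sum[OF q xq] \<kappa>_def[symmetric]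
      phi01_mu_sum_casorati[OF q(2,3) generic(1) nz, symmetric] by (simp add: algebra_simps)
qed

lemma qt_fib_rec_little_mu:
  fixes q x y \<tau> :: complex
  assumes q: "q = nome \<tau>" "q \<noteq> 0" "norm q < 1" and "y \<noteq> 0" "x \<notin> qint_powers q"
  shows "qt_fib_rec (x * y) q (\<lambda>n. little_mu \<tau> (x * q powi (n - 1)) y)"
proof -
  have "little_mu \<tau> (x * q powi (n - 1)) y
      = \<i> * qpow \<tau> (- 1 / 8) / (qpoch_inf q q * theta q (q * y)) * mu_sum q (x * q powi (n - 1)) y" for n
    by (rule little_mu_eq_mu_sum[OF q]) (use assms in \<open>simp add: qint_powers_mult_iff\<close>)
  then show ?thesis using qt_fib_rec_mu_sum[OF q(2,3) assms(5,4)] by (simp only:)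
qed

text \<open>Let A and B be the sequences of the two little \<open>\<mu>\<close>-functions and H
  that of \<open>\<^sub>0\<phi>\<^sub>1\<close>. By \<open>little_mu_diff\<close>,
  \<open>A - B\<close> is a multiple of H at two consecutive places, so the Casoratian of A and
  B is that multiple of the known Casoratian of H and B.\<close>

lemma little_mu_casorati:
  fixes q x y c \<tau> :: complex
  assumes q: "q = nome \<tau>" "q \<noteq> 0" "norm q < 1"
    and nz: "x \<noteq> 0" "y \<noteq> 0" "c \<noteq> 0"
    and generic: "x \<notin> qint_powers q" "y \<notin> qint_powers q" "x / c \<notin> qint_powers q" "y * c \<notin> qint_powers q"
  shows "little_mu \<tau> (x / c / q) (y * c) * little_mu \<tau> x y - little_mu \<tau> (x / c) (y * c) * little_mu \<tau> (x / q) y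
    = qpow \<tau> (- 1 / 4) * theta_quot q x y c"
proof -
  define \<omega> where "\<omega> = \<i> * qpow \<tau> (- 1 / 8)"
  define h0 where "h0 = phi01 q (x * y * q)"
  define h1 where "h1 = - (x * y) * phi01 q (x * y * q ^ 2)"
  define a0 where "a0 = little_mu \<tau> (x / c / q) (y * c)"
  define a1 where "a1 = little_mu \<tau> (x / c) (y * c)"
  define b0 where "b0 = little_mu \<tau> (x / q) y"
  define b1 where "b1 = little_mu \<tau> x y"
  define K where "K = theta_quot q x y c"
  have \<omega>: "\<omega> \<noteq> 0" by (simp add: \<omega>_def qpow_nonzero)
  have shift: "z / q \<notin> qint_powers q" if "z \<notin> qint_powers q" for z
    using qint_powers_mult_iff[OF q(2), of z "-1"] that by (simp add: power_int_minus divide_inverse)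
  have B: "h0 * b1 - h1 * b0 = \<omega>"
    using phi01_little_mu_casorati[OF q nz(1,2) generic(1,2)]
    by (simp add: h0_def h1_def b0_def b1_def \<omega>_def)
  have A: "h0 * a1 - h1 * a0 = \<omega>"
    using phi01_little_mu_casorati[OF q _ _ generic(3,4)] nz
    by (simp add: h0_def h1_def a0_def a1_def \<omega>_def)
  have d1: "a1 - b1 = - \<omega> * K * h1"
    using little_mu_diff[OF q nz generic] by (simp add: a1_def b1_def K_def h1_def \<omega>_def)
  have d0: "a0 - b0 = - \<omega> * K * h0"
  proof -
    have "x / q \<noteq> 0" "x / q / c = x / c / q" "x / q * y * q ^ 2 = x * y * q"
      using nz q(2) by (simp_all add: power2_eq_square field_simps)
    then have "a0 - b0 = \<omega> * (x / q * y) * h0 * theta_quot q (x / q) y c"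
      using little_mu_diff[OF q _ nz(2,3) shift[OF generic(1)] generic(2) _ generic(4)] shift[OF generic(3)]
      by (simp only: a0_def b0_def h0_def \<omega>_def simp_thms)
    also have "\<dots> = \<omega> * h0 * (x * y * theta_quot q (x / q) y c) / q" by simp
    also have "\<dots> = - \<omega> * K * h0"
      unfolding theta_quot_div_q[OF q(2,3) nz] K_def using q(2) by simp
    finally show ?thesis .
  qed
  \<comment> \<open>Either of the values h0 and h1 can vanish, but not both, so the claim is shown after
    multiplication by each of them.\<close>
  have "h0 * (a0 * b1 - a1 * b0) = a0 * (h0 * b1) - b0 * (h0 * a1)" by (simp add: algebra_simps)
  also have "\<dots> = \<omega> * (a0 - b0)" using A B by (simp add: algebra_simps)
  finally have w0: "h0 * (a0 * b1 - a1 * b0) = h0 * (- (\<omega> ^ 2) * K)"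
    unfolding d0 by (simp add: power2_eq_square)
  have "h1 * (a0 * b1 - a1 * b0) = (h1 * a0) * b1 - a1 * (h1 * b0)" by (simp add: algebra_simps)
  also have "h1 * a0 = h0 * a1 - \<omega>" using A by (simp add: algebra_simps)
  also have "h1 * b0 = h0 * b1 - \<omega>" using B by (simp add: algebra_simps)
  also have "(h0 * a1 - \<omega>) * b1 - a1 * (h0 * b1 - \<omega>) = \<omega> * (a1 - b1)" by (simp add: algebra_simps)
  finally have w1: "h1 * (a0 * b1 - a1 * b0) = h1 * (- (\<omega> ^ 2) * K)"
    unfolding d1 by (simp add: power2_eq_square)
  have "h0 \<noteq> 0 \<or> h1 \<noteq> 0" using B \<omega> by auto
  then have "a0 * b1 - a1 * b0 = - (\<omega> ^ 2) * K"
    using w0 w1 by (metis mult_left_cancel)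
  moreover have "- (\<omega> ^ 2) = qpow \<tau> (- 1 / 4)"
    using qpow_add[of \<tau> "- 1 / 8" "- 1 / 8"]
    by (simp add: \<omega>_def power_mult_distrib flip: power2_eq_square)
  ultimately show ?thesis by (simp only: a0_def a1_def b0_def b1_def K_def)
qed

theorem theorem4:
  fixes \<tau> q x y c :: complex
  assumes tau: "Im \<tau> > 0"
    and q: "q = nome \<tau>"
    and nonzero: "x \<noteq> 0" "y \<noteq> 0" "c \<noteq> 0"
    and generic: "x \<notin> qint_powers q" "y \<notin> qint_powers q"
      "x / c \<notin> qint_powers q" "y * c \<notin> qint_powers q"
  shows
    "(\<forall>m n :: int.
        little_mu \<tau> (x / c * q powi (n - 1)) (y * c) * little_mu \<tau> (x * q powi (m - 1)) y
        - little_mu \<tau> (x / c * q powi (m - 1)) (y * c) * little_mu \<tau> (x * q powi (n - 1)) y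
        = qpow \<tau> (- 1 / 4) * theta q c * theta q (y * c / x)
            / (theta q (c / x) * theta q (y * c) * theta q x * theta q y)
          * (fibS m (x * y) q * fibT (n - 1) (x * y) q
             - fibS n (x * y) q * fibT (m - 1) (x * y) q)) \<and>
     (\<forall>m n :: int.
        (- x * y) powi n * q powi (n * (n - 1) div 2) * phi01 q (x * y * q powi (n + 1))
          * little_mu \<tau> (x * q powi (m - 1)) y
        - (- x * y) powi m * q powi (m * (m - 1) div 2) * phi01 q (x * y * q powi (m + 1))
          * little_mu \<tau> (x * q powi (n - 1)) y
        = \<i> * qpow \<tau> (- 1 / 8)
          * (fibS m (x * y) q * fibT (n - 1) (x * y) q
             - fibS n (x * y) q * fibT (m - 1) (x * y) q)) \<and>
     (\<forall>n :: int.
        little_mu \<tau> (x / c * q powi (n - 1)) (y * c) * little_mu \<tau> (x * q powi n) y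
        - little_mu \<tau> (x / c * q powi n) (y * c) * little_mu \<tau> (x * q powi (n - 1)) y
        = (- x * y) powi n * qpow \<tau> (of_int (n * (n - 1)) / 2 - 1 / 4)
            * theta q c * theta q (y * c / x)
            / (theta q (c / x) * theta q (y * c) * theta q x * theta q y)) \<and>
     (\<forall>n :: int.
        phi01 q (x * y * q powi (n + 1)) * little_mu \<tau> (x * q powi n) y
        + x * y * q powi n * phi01 q (x * y * q powi (n + 2))
          * little_mu \<tau> (x * q powi (n - 1)) y
        = \<i> * qpow \<tau> (- 1 / 8)) \<and>
     little_mu \<tau> (x / (c * q)) (y * c) * little_mu \<tau> x y
       - little_mu \<tau> (x / c) (y * c) * little_mu \<tau> (x / q) y
       = qpow \<tau> (- 1 / 4) * theta q c * theta q (y * c / x)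
           / (theta q (c / x) * theta q (y * c) * theta q x * theta q y) \<and>
     phi01 q (x * y * q) * little_mu \<tau> x y
       + x * y * phi01 q (x * y * q\<^sup>2) * little_mu \<tau> (x / q) y
       = \<i> * qpow \<tau> (- 1 / 8)"
proof -
  have q0: "q \<noteq> 0" and q1: "norm q < 1"
    using tau by (simp_all add: q qpow_nonzero norm_nome_less_1)
  note qq = q q0 q1
  define t where "t = x * y"
  have t: "t \<noteq> 0" using nonzero by (simp add: t_def)
  define \<omega> where "\<omega> = \<i> * qpow \<tau> (- 1 / 8)"
  define K where "K = qpow \<tau> (- 1 / 4) * theta_quot q x y c"
  define A where "A n = little_mu \<tau> (x / c * q powi (n - 1)) (y * c)" for n
  define B where "B n = little_mu \<tau> (x * q powi (n - 1)) y" for n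
  define H where "H n = (- t) powi n * q powi tri n * phi01 q (t * q powi (n + 1))" for n
  have recA: "qt_fib_rec t q A"
    using qt_fib_rec_little_mu[OF qq, of "y * c" "x / c"] nonzero generic by (simp add: A_def[abs_def] t_def)
  have recB: "qt_fib_rec t q B"
    using qt_fib_rec_little_mu[OF qq, of y x] nonzero generic by (simp add: B_def[abs_def] t_def)
  have recH: "qt_fib_rec t q H"
    unfolding H_def using qt_fib_rec_phi01[OF q0 q1 t] .
  have init: "A 0 = little_mu \<tau> (x / c / q) (y * c)" "A 1 = little_mu \<tau> (x / c) (y * c)"
    "B 0 = little_mu \<tau> (x / q) y" "B 1 = little_mu \<tau> x y"
    by (simp_all add: A_def B_def power_int_minus divide_inverse)
  have AB: "A 0 * B 1 - A 1 * B 0 = K"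
    unfolding init K_def by (rule little_mu_casorati[OF qq nonzero generic])
  have phi_mu: "phi01 q (t * q) * little_mu \<tau> x y + t * phi01 q (t * q ^ 2) * little_mu \<tau> (x / q) y = \<omega>"
    unfolding t_def \<omega>_def by (rule phi01_little_mu_casorati[OF qq nonzero(1,2) generic(1,2)])
  have HB: "H 0 * B 1 - H 1 * B 0 = \<omega>"
    using phi_mu unfolding init by (simp add: H_def)
  have part1: "A n * B m - A m * B n = K * (fibS m t q * fibT (n - 1) t q - fibS n t q * fibT (m - 1) t q)" for m n
    using casorati_eq[OF t q0 recA recB, of n m] unfolding AB .
  have part2: "H n * B m - H m * B n = \<omega> * (fibS m t q * fibT (n - 1) t q - fibS n t q * fibT (m - 1) t q)" for m n
    using casorati_eq[OF t q0 recH recB, of n m] unfolding HB .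
  have part3: "A n * B (n + 1) - A (n + 1) * B n = (- t) powi n * q powi tri n * K" for n
    using casorati_closed_form[OF t q0 recA recB, of n] unfolding AB .
  have part4: "phi01 q (t * q powi (n + 1)) * B (n + 1) + t * q powi n * phi01 q (t * q powi (n + 2)) * B n = \<omega>" for n
  proof -
    define P where "P = (- t) powi n * q powi tri n"
    have P: "P \<noteq> 0" using t q0 by (simp add: P_def)
    have H0: "H n = P * phi01 q (t * q powi (n + 1))" by (simp add: H_def P_def)
    have "n + 1 + 1 = n + 2" by simp
    then have H1: "H (n + 1) = P * (- t * q powi n) * phi01 q (t * q powi (n + 2))"
      using q0 t by (simp only: H_def P_def tri_Suc power_int_add_1) (simp add: power_int_add)
    have "P * (phi01 q (t * q powi (n + 1)) * B (n + 1) + t * q powi n * phi01 q (t * q powi (n + 2)) * B n) = P * \<omega>"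
      using casorati_closed_form[OF t q0 recH recB, of n] unfolding HB H0 H1 P_def[symmetric]
      by (simp add: algebra_simps)
    then show ?thesis using P by simp
  qed
  have mt: "- x * y = - t" by (simp add: t_def)
  have Kq: "qpow \<tau> (- 1 / 4) * theta q c * theta q (y * c / x)
      / (theta q (c / x) * theta q (y * c) * theta q x * theta q y) = K"
    by (simp add: K_def theta_quot_def)
  have qpow_tri: "qpow \<tau> (of_int (n * (n - 1)) / 2 - 1 / 4) = q powi tri n * qpow \<tau> (- 1 / 4)" for n
  proof -
    have "of_int (n * (n - 1)) / 2 = (of_int (tri n) :: real)"
      using two_tri[of n, symmetric] by simp
    then have "of_int (n * (n - 1)) / 2 - 1 / 4 = of_int (tri n) + (- 1 / 4 :: real)" by simp
    then show ?thesis by (simp only: qpow_add qpow_of_int q)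
  qed
  show ?thesis
  proof (intro conjI allI)
    fix m n :: int
    show "little_mu \<tau> (x / c * q powi (n - 1)) (y * c) * little_mu \<tau> (x * q powi (m - 1)) y
        - little_mu \<tau> (x / c * q powi (m - 1)) (y * c) * little_mu \<tau> (x * q powi (n - 1)) y
        = qpow \<tau> (- 1 / 4) * theta q c * theta q (y * c / x)
            / (theta q (c / x) * theta q (y * c) * theta q x * theta q y)
          * (fibS m (x * y) q * fibT (n - 1) (x * y) q
             - fibS n (x * y) q * fibT (m - 1) (x * y) q)"
      unfolding Kq using part1[of n m] by (simp only: A_def B_def t_def)
    show "(- x * y) powi n * q powi (n * (n - 1) div 2) * phi01 q (x * y * q powi (n + 1))
          * little_mu \<tau> (x * q powi (m - 1)) y
        - (- x * y) powi m * q powi (m * (m - 1) div 2) * phi01 q (x * y * q powi (m + 1))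
          * little_mu \<tau> (x * q powi (n - 1)) y
        = \<i> * qpow \<tau> (- 1 / 8)
          * (fibS m (x * y) q * fibT (n - 1) (x * y) q
             - fibS n (x * y) q * fibT (m - 1) (x * y) q)"
      unfolding mt using part2[of n m] by (simp only: H_def B_def t_def \<omega>_def tri_def)
  next
    fix n :: int
    have n: "n + 1 - 1 = n" by simp
    have "(- x * y) powi n * qpow \<tau> (of_int (n * (n - 1)) / 2 - 1 / 4)
            * theta q c * theta q (y * c / x)
            / (theta q (c / x) * theta q (y * c) * theta q x * theta q y) = (- t) powi n * q powi tri n * K"
      unfolding mt qpow_tri K_def theta_quot_def by simp
    then show "little_mu \<tau> (x / c * q powi (n - 1)) (y * c) * little_mu \<tau> (x * q powi n) y
        - little_mu \<tau> (x / c * q powi n) (y * c) * little_mu \<tau> (x * q powi (n - 1)) y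
        = (- x * y) powi n * qpow \<tau> (of_int (n * (n - 1)) / 2 - 1 / 4)
            * theta q c * theta q (y * c / x)
            / (theta q (c / x) * theta q (y * c) * theta q x * theta q y)"
      using part3[of n] by (simp only: A_def B_def n)
    show "phi01 q (x * y * q powi (n + 1)) * little_mu \<tau> (x * q powi n) y
        + x * y * q powi n * phi01 q (x * y * q powi (n + 2))
          * little_mu \<tau> (x * q powi (n - 1)) y
        = \<i> * qpow \<tau> (- 1 / 8)"
      using part4[of n] by (simp only: B_def n t_def \<omega>_def)
  next
    have "x / (c * q) = x / c / q" by simp
    then show "little_mu \<tau> (x / (c * q)) (y * c) * little_mu \<tau> x y
       - little_mu \<tau> (x / c) (y * c) * little_mu \<tau> (x / q) y
       = qpow \<tau> (- 1 / 4) * theta q c * theta q (y * c / x)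
           / (theta q (c / x) * theta q (y * c) * theta q x * theta q y)"
      unfolding Kq using AB unfolding init by (simp only:)
    show "phi01 q (x * y * q) * little_mu \<tau> x y
       + x * y * phi01 q (x * y * q\<^sup>2) * little_mu \<tau> (x / q) y
       = \<i> * qpow \<tau> (- 1 / 8)"
      using phi_mu by (simp only: t_def \<omega>_def)
  qed
qed

end
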